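(* Let $(f_n)_{n\ge 0}$ be independent identically distributed complex Gaussian random variables with expectation $0$ and variance $1$, let $\mathfrak{f}_{\mathbb{D}}(z)=\sum_{n=0}^\infty f_n z^n$ (which almost surely has radius of convergence $1$), and let $Z(\mathfrak{f}_{\mathbb{D}})=\{z\in\mathbb{D}:\mathfrak{f}_{\mathbb{D}}(z)=0\}$. Then, almost surely, $Z(\mathfrak{f}_{\mathbb{D}})$ is a uniqueness set for the Bergman space $A^2(\mathbb{D})$.
   Context: $\mathbb{D}$ is the open unit disc in $\mathbb{C}$. Complex Gaussian with expectation $0$ and variance $1$ means the standard (circularly symmetric) complex Gaussian with $\mathbb{E}|f_n|^2=1$. $A^2(\mathbb{D})$ is the Bergman space of holomorphic functions on $\mathbb{D}$ that are square-integrable with respect to Lebesgue measure. A subset $X\subset\mathbb{D}$ is a uniqueness set for $A^2(\mathbb{D})$ if every $h\in A^2(\mathbb{D})$ with $h|_X=0$ is identically zero. *)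

theory Defs
  imports "HOL-Probability.Probability" "HOL-Complex_Analysis.Complex_Analysis"
begin

text \<open>Density \<open>(1 / \<pi>) exp (- |z|\<^sup>2)\<close> with respect to planar Lebesgue measure: the circularly
  symmetric complex Gaussian law normalised by \<open>E |X|\<^sup>2 = 1\<close>, so that the real and the imaginary
  part each have variance \<open>1/2\<close>.\<close>

definition std_complex_gaussian_density :: "complex \<Rightarrow> real" where
  "std_complex_gaussian_density z = exp (- (cmod z)\<^sup>2) / pi"

definition std_complex_gaussian :: "'a measure \<Rightarrow> ('a \<Rightarrow> complex) \<Rightarrow> bool" where
  "std_complex_gaussian M X \<longleftrightarrow> distributed M lborel X std_complex_gaussian_density"

abbreviation unit_disc :: "complex set" where
  "unit_disc \<equiv> ball 0 1"

text \<open>The coefficient sequence is deterministic; the random series is obtained by evaluating the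
  coefficients at a sample point.  The value of \<open>power_series a z\<close> is meaningful only
  where the series converges.\<close>

definition power_series :: "(nat \<Rightarrow> complex) \<Rightarrow> complex \<Rightarrow> complex" where
  "power_series a z = (\<Sum>n. a n * z ^ n)"

definition disc_zeros :: "(complex \<Rightarrow> complex) \<Rightarrow> complex set" where
  "disc_zeros F = {z \<in> unit_disc. F z = 0}"

text \<open>Elements are total functions on \<open>\<complex>\<close>; only their restriction to the disc matters, so being
  identically zero means vanishing on the disc.\<close>

definition bergman_space :: "(complex \<Rightarrow> complex) set" where
  "bergman_space =
     {h. h holomorphic_on unit_disc \<and> set_integrable lborel unit_disc (\<lambda>z. (cmod (h z))\<^sup>2)}"

definition bergman_uniqueness_set :: "complex set \<Rightarrow> bool" where
  "bergman_uniqueness_set X \<longleftrightarrow> X \<subseteq> unit_disc \<and>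
     (\<forall>h\<in>bergman_space. (\<forall>z\<in>X. h z = 0) \<longrightarrow> (\<forall>z\<in>unit_disc. h z = 0))"

end

theory Submission
  imports Defs
begin

text \<open>Let \<open>F\<close> be the random power series. Almost surely its zeros are simple, so every \<open>h\<close> in the
  Bergman space vanishing on them factors as \<open>h = F g\<close> with \<open>g\<close> holomorphic. By Jensen's inequality
  the mean of \<open>|h|\<^sup>2\<close> over a thin annulus \<open>A\<^sub>k\<close> at distance about \<open>2\<^bsup>-k\<^esup>\<close> from the unit circle is at
  least the exponential of the mean of \<open>ln |F|\<^sup>2 + ln |g|\<^sup>2\<close>. The mean of \<open>ln |g|\<^sup>2\<close> stays bounded below
  by subharmonicity. As \<open>F z\<close> is Gaussian with variance \<open>1 / (1 - |z|\<^sup>2)\<close>, the expected negative part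
  of \<open>ln ((1 - |z|\<^sup>2) |F z|\<^sup>2)\<close> is bounded uniformly in \<open>z\<close>; by Fatou's lemma, almost surely its mean over
  \<open>A\<^sub>k\<close> stays bounded for infinitely many \<open>k\<close>. For these \<open>k\<close> the mean of \<open>|h|\<^sup>2\<close> is at least a constant
  times \<open>2\<^sup>k\<close>, while \<open>A\<^sub>k\<close> has area of order \<open>2\<^bsup>-k\<^esup>\<close>. So the integral of \<open>|h|\<^sup>2\<close> over \<open>A\<^sub>k\<close> does not tend
  to \<open>0\<close>, which is impossible for integrable \<open>|h|\<^sup>2\<close>.\<close>

subsection \<open>Rotation invariance of planar Lebesgue measure\<close>

lemma measurable_Complex [measurable]:
  assumes [measurable]: "f \<in> borel_measurable M" "g \<in> borel_measurable M"
  shows "(\<lambda>x. Complex (f x) (g x)) \<in> borel_measurable M"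
  unfolding Complex_eq by measurable

text \<open>Lebesgue measure is determined by its values on open boxes, and both sides give
  \<open>box l u\<close> the product of its side lengths. This makes Tonelli available in the
  plane.\<close>

lemma lborel_complex_eq_distr:
  "(lborel :: complex measure) = distr (lborel \<Otimes>\<^sub>M lborel) borel (\<lambda>(x, y). Complex x y)"
proof (rule lborel_eqI)
  fix l u :: complex
  assume le: "\<And>b. b \<in> Basis \<Longrightarrow> l \<bullet> b \<le> u \<bullet> b"
  have le': "Re l \<le> Re u" "Im l \<le> Im u"
    using le[of 1] le[of \<i>] by (auto simp: Basis_complex_def inner_complex_def)
  have vimage: "(\<lambda>(x, y). Complex x y) -` box l u = {Re l<..<Re u} \<times> {Im l<..<Im u}"
    by (auto simp: box_def Basis_complex_def inner_complex_def)
  show "emeasure (distr (lborel \<Otimes>\<^sub>M lborel) borel (\<lambda>(x, y). Complex x y)) (box l u) =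
      ennreal (\<Prod>b\<in>Basis. (u - l) \<bullet> b)"
    using le'
    by (subst emeasure_distr)
       (auto simp: vimage space_pair_measure lborel.emeasure_pair_measure_Times ennreal_mult[symmetric]
         Basis_complex_def inner_complex_def)
qed simp

lemma nn_integral_lborel_complex:
  assumes [measurable]: "f \<in> borel_measurable borel"
  shows "(\<integral>\<^sup>+z. f z \<partial>lborel) = (\<integral>\<^sup>+x. \<integral>\<^sup>+y. f (Complex x y) \<partial>lborel \<partial>lborel)"
    and "(\<integral>\<^sup>+z. f z \<partial>lborel) = (\<integral>\<^sup>+y. \<integral>\<^sup>+x. f (Complex x y) \<partial>lborel \<partial>lborel)"
proof -
  have "(\<integral>\<^sup>+z. f z \<partial>lborel) = (\<integral>\<^sup>+p. f (case p of (x, y) \<Rightarrow> Complex x y) \<partial>(lborel \<Otimes>\<^sub>M lborel))"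
    by (subst lborel_complex_eq_distr) (simp add: nn_integral_distr)
  also have "\<dots> = (\<integral>\<^sup>+x. \<integral>\<^sup>+y. f (Complex x y) \<partial>lborel \<partial>lborel)"
    by (subst lborel.nn_integral_fst[symmetric]) auto
  finally show 1: "(\<integral>\<^sup>+z. f z \<partial>lborel) = (\<integral>\<^sup>+x. \<integral>\<^sup>+y. f (Complex x y) \<partial>lborel \<partial>lborel)" .
  show "(\<integral>\<^sup>+z. f z \<partial>lborel) = (\<integral>\<^sup>+y. \<integral>\<^sup>+x. f (Complex x y) \<partial>lborel \<partial>lborel)"
    unfolding 1 by (rule lborel_pair.Fubini'[symmetric]) measurable
qed

text \<open>A shear translates one coordinate by an amount depending only on the other, so
  translation invariance on the line applies once the translated coordinate is the inner variable of
  integration.\<close>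

lemma nn_integral_lborel_shear:
  fixes a :: real
  assumes [measurable]: "f \<in> borel_measurable borel"
  shows "(\<integral>\<^sup>+z. f (Complex (Re z + a * Im z) (Im z)) \<partial>lborel) = (\<integral>\<^sup>+z. f z \<partial>lborel)"
    and "(\<integral>\<^sup>+z. f (Complex (Re z) (Im z + a * Re z)) \<partial>lborel) = (\<integral>\<^sup>+z. f z \<partial>lborel)"
proof -
  have "(\<integral>\<^sup>+x. f (Complex (x + a * y) y) \<partial>lborel) = (\<integral>\<^sup>+x. f (Complex x y) \<partial>lborel)" for y
    using nn_integral_real_affine[of "\<lambda>x. f (Complex x y)" 1 "a * y"] by (simp add: add.commute)
  then show "(\<integral>\<^sup>+z. f (Complex (Re z + a * Im z) (Im z)) \<partial>lborel) = (\<integral>\<^sup>+z. f z \<partial>lborel)"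
    by (simp add: nn_integral_lborel_complex(2))
  have "(\<integral>\<^sup>+y. f (Complex x (y + a * x)) \<partial>lborel) = (\<integral>\<^sup>+y. f (Complex x y) \<partial>lborel)" for x
    using nn_integral_real_affine[of "\<lambda>y. f (Complex x y)" 1 "a * x"] by (simp add: add.commute)
  then show "(\<integral>\<^sup>+z. f (Complex (Re z) (Im z + a * Re z)) \<partial>lborel) = (\<integral>\<^sup>+z. f z \<partial>lborel)"
    by (simp add: nn_integral_lborel_complex(1))
qed

text \<open>A rotation by an angle other than \<open>\<pi>\<close> is a product of three shears.\<close>

lemma nn_integral_lborel_rotate:
  assumes [measurable]: "f \<in> borel_measurable borel" and u: "cmod u = 1"
  shows "(\<integral>\<^sup>+z. f (u * z) \<partial>lborel) = (\<integral>\<^sup>+z. f z \<partial>lborel)"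
proof -
  have main: "(\<integral>\<^sup>+z. f (u * z) \<partial>lborel) = (\<integral>\<^sup>+z. f z \<partial>lborel)"
    if [measurable]: "f \<in> borel_measurable borel" and u: "cmod u = 1" "u \<noteq> -1"
    for f :: "complex \<Rightarrow> ennreal" and u
  proof -
    define c s where "c = Re u" and "s = Im u"
    have cs: "c * c + s * s = 1"
      using u(1) by (simp add: c_def s_def cmod_def power2_eq_square)
    have c1: "1 + c \<noteq> 0"
    proof
      assume "1 + c = 0"
      then have "c = -1" by simp
      with cs have "s = 0" by simp
      with \<open>c = -1\<close> u(2) show False by (simp add: c_def s_def complex_eq_iff)
    qed
    \<comment> \<open>For \<open>u = cis \<theta>\<close> this is
      \<open>- tan (\<theta> / 2)\<close>, the coefficient of the two outer shears; the middle one
      has coefficient \<open>sin \<theta> = s\<close>. Here \<open>u \<noteq> -1\<close>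
      enters.\<close>
    define t where "t = - s / (1 + c)"
    have ts: "1 + t * s = c"
      using c1 cs by (simp add: t_def field_simps)
    have t2: "t + (1 + t * s) * t = - s"
    proof -
      have "t * (1 + c) = - s" using c1 by (simp add: t_def)
      then show ?thesis unfolding ts by (simp add: algebra_simps)
    qed
    define S where "S = (\<lambda>z. Complex (Re z + t * Im z) (Im z))"
    define T where "T = (\<lambda>z. Complex (Re z) (Im z + s * Re z))"
    have [measurable]: "S \<in> borel_measurable borel" "T \<in> borel_measurable borel"
      unfolding S_def T_def by measurable
    have rot: "u * z = S (T (S z))" for z
    proof -
      have "Re (S (T (S z))) = (1 + t * s) * Re z + (t + (1 + t * s) * t) * Im z"
        "Im (S (T (S z))) = s * Re z + (1 + t * s) * Im z"
        by (simp_all add: S_def T_def algebra_simps)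
      then show ?thesis
        unfolding t2 unfolding ts by (simp add: complex_eq_iff c_def s_def)
    qed
    have "(\<integral>\<^sup>+z. f (u * z) \<partial>lborel) = (\<integral>\<^sup>+z. f (S (T (S z))) \<partial>lborel)"
      by (simp add: rot)
    also have "\<dots> = (\<integral>\<^sup>+z. f (S (T z)) \<partial>lborel)"
      unfolding S_def by (rule nn_integral_lborel_shear(1)[of "\<lambda>z. f (S (T z))" t, unfolded S_def]) (simp add: T_def)
    also have "\<dots> = (\<integral>\<^sup>+z. f (S z) \<partial>lborel)"
      unfolding T_def by (rule nn_integral_lborel_shear(2)) simp
    also have "\<dots> = (\<integral>\<^sup>+z. f z \<partial>lborel)"
      unfolding S_def by (rule nn_integral_lborel_shear(1)) simp
    finally show ?thesis .
  qed
  show ?thesis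
  proof (cases "u = -1")
    \<comment> \<open>Multiplication by \<open>-1\<close> is multiplication by \<open>\<i>\<close>
      twice, and \<open>main\<close> covers \<open>\<i>\<close>.\<close>
    case True
    have "(\<integral>\<^sup>+z. f (u * z) \<partial>lborel) = (\<integral>\<^sup>+z. f (\<i> * (\<i> * z)) \<partial>lborel)"
      by (simp add: True mult.assoc[symmetric])
    also have "\<dots> = (\<integral>\<^sup>+z. f (\<i> * z) \<partial>lborel)"
      by (rule main[of "\<lambda>z. f (\<i> * z)"]) (auto simp: complex_eq_iff)
    also have "\<dots> = (\<integral>\<^sup>+z. f z \<partial>lborel)"
      by (rule main) (auto simp: complex_eq_iff)
    finally show ?thesis .
  qed (use main u in auto)
qed

lemma lborel_distr_rotate:
  assumes "cmod u = 1"
  shows "distr lborel borel ((*) u) = (lborel :: complex measure)"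
proof (rule measure_eqI)
  fix A :: "complex set"
  assume "A \<in> sets (distr lborel borel ((*) u))"
  then have A [measurable]: "A \<in> sets borel" by simp
  have "emeasure (distr lborel borel ((*) u)) A = (\<integral>\<^sup>+z. indicator A z \<partial>distr lborel borel ((*) u))"
    by simp
  also have "\<dots> = (\<integral>\<^sup>+z. indicator A (u * z) \<partial>lborel)"
    by (rule nn_integral_distr) auto
  also have "\<dots> = emeasure lborel A"
    using nn_integral_lborel_rotate[OF _ assms, of "indicator A"] A by simp
  finally show "emeasure (distr lborel borel ((*) u)) A = emeasure lborel A" .
qed simp

subsection \<open>Means over annuli\<close>

definition annulus :: "real \<Rightarrow> real \<Rightarrow> complex set" where
  "annulus r R = {z. r \<le> cmod z \<and> cmod z \<le> R}"

lemma annulus_eq: "annulus r R = cball 0 R - ball 0 r"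
  by (auto simp: annulus_def)

lemma compact_annulus: "compact (annulus r R)"
  unfolding annulus_eq by (intro compact_diff compact_cball open_ball)

lemma annulus_borel [measurable]: "annulus r R \<in> sets borel"
  by (simp add: borel_compact compact_annulus)

lemma emeasure_annulus_finite: "emeasure lborel (annulus r R) < \<infinity>"
  by (intro emeasure_bounded_finite compact_imp_bounded compact_annulus)

lemma measure_annulus:
  assumes "0 \<le> r" "r \<le> R"
  shows "measure lborel (annulus r R) = pi * (R\<^sup>2 - r\<^sup>2)"
proof -
  have "measure lborel (annulus r R) = measure lborel (cball (0::complex) R) - measure lborel (ball (0::complex) r)"
    unfolding annulus_eq using assms
    by (intro measure_Diff) (auto simp: emeasure_ball emeasure_cball subset_eq)
  then show ?thesis
    using assms by (simp add: content_ball content_cball unit_ball_vol_2 algebra_simps)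
qed

lemma set_integrable_annulus:
  fixes u :: "complex \<Rightarrow> real"
  assumes "continuous_on (annulus r R) u"
  shows "set_integrable lborel (annulus r R) u"
  unfolding set_integrable_def by (rule borel_integrable_compact[OF compact_annulus assms])

lemma set_integral_annulus_rotate:
  fixes u :: "complex \<Rightarrow> real"
  assumes "continuous_on (annulus r R) u" "cmod w = 1"
  shows "(LINT z:annulus r R|lborel. u (z * w)) = (LINT z:annulus r R|lborel. u z)"
proof -
  have [measurable]: "(\<lambda>z. indicator (annulus r R) z *\<^sub>R u z) \<in> borel_measurable borel"
    using borel_measurable_continuous_on_indicator[OF _ assms(1)] by simp
  have ind: "indicator (annulus r R) (w * z) = (indicator (annulus r R) z :: real)" for z
    by (auto simp: indicator_def annulus_def norm_mult assms(2))
  have "(LINT z:annulus r R|lborel. u z) = (LINT z|distr lborel borel ((*) w). indicator (annulus r R) z *\<^sub>R u z)"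
    unfolding set_lebesgue_integral_def by (simp add: lborel_distr_rotate assms)
  also have "\<dots> = (LINT z:annulus r R|lborel. u (z * w))"
  proof -
    have "(LINT z|distr lborel borel ((*) w). indicator (annulus r R) z *\<^sub>R u z) =
        (LINT z|lborel. indicator (annulus r R) (w * z) *\<^sub>R u (w * z))"
      by (rule integral_distr) measurable
    then show ?thesis
      unfolding set_lebesgue_integral_def ind by (simp only: mult.commute)
  qed
  finally show ?thesis by simp
qed

lemma sum_cyclic_shift:
  fixes p :: "nat \<Rightarrow> real"
  assumes "\<And>j. p (j + N) = p j"
  shows "(\<Sum>j<N. p (i + j)) = (\<Sum>j<N. p j)"
proof (induction i)
  case (Suc i)
  have "(\<Sum>j<N. p (Suc i + j)) + p i = (\<Sum>j<Suc N. p (i + j))"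
    by (subst sum.lessThan_Suc_shift) (simp add: add.commute)
  also have "\<dots> = (\<Sum>j<N. p (i + j)) + p i"
    by (simp add: assms)
  finally show ?case using Suc by simp
qed simp

text \<open>The maximum principle for \<open>\<Prod>j<N. g (w \<omega>\<^sup>j)\<close> replaces Jensen's formula and needs no
  information on the zeros of \<open>g\<close>.\<close>

lemma exists_root_mean_ge:
  assumes g: "g holomorphic_on ball 0 1"
    and \<rho>: "0 \<le> \<rho>" "\<rho> \<le> s" "s < 1" and m: "0 < m" "\<And>z. cmod z = \<rho> \<Longrightarrow> m \<le> cmod (g z)"
    and \<omega>: "cmod \<omega> = 1" and N: "0 < N"
  obtains w where "cmod w = s" "m ^ N \<le> (\<Prod>j<N. cmod (g (w * \<omega> ^ j)))"
proof -
  define G where "G = (\<lambda>w. \<Prod>j<N. g (w * \<omega> ^ j))"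
  have hol: "(\<lambda>w. g (w * \<omega> ^ j)) holomorphic_on ball 0 1" for j
    by (rule holomorphic_on_compose_gen[OF _ g, of "\<lambda>w. w * \<omega> ^ j", unfolded o_def])
       (auto intro!: holomorphic_intros simp: norm_mult norm_power \<omega>)
  have G: "G holomorphic_on ball 0 1"
    unfolding G_def by (intro holomorphic_on_prod hol)
  have sub: "cball 0 s \<subseteq> ball (0::complex) 1" using \<rho> by auto
  have cont: "continuous_on (cball 0 s) G"
    using holomorphic_on_imp_continuous_on[OF holomorphic_on_subset[OF G sub]] .
  have "sphere (0::complex) s \<noteq> {}" using \<rho> by simp
  moreover have "continuous_on (sphere 0 s) (\<lambda>w. cmod (G w))"
    by (intro continuous_on_norm continuous_on_subset[OF cont]) auto
  ultimately obtain w where w: "w \<in> sphere 0 s" "\<And>w'. w' \<in> sphere 0 s \<Longrightarrow> cmod (G w') \<le> cmod (G w)"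
    using continuous_attains_sup[OF compact_sphere] by metis
  \<comment> \<open>\<open>G \<rho>\<close> is a product of \<open>N\<close> values of
    \<open>g\<close> on the circle where \<open>|g| \<ge> m\<close>; the maximum principle on the
    disc of radius \<open>s\<close> carries this lower bound to the maximum point \<open>w\<close>
    on its boundary.\<close>
  have "cmod (G (of_real \<rho>)) \<le> cmod (G w)"
  proof (rule maximum_modulus_frontier[of G "cball 0 s"])
    show "G holomorphic_on interior (cball 0 s)"
      using \<rho> by (intro holomorphic_on_subset[OF G]) auto
    show "continuous_on (closure (cball 0 s)) G" using cont by simp
    show "cmod (G z) \<le> cmod (G w)" if "z \<in> frontier (cball 0 s)" for z
      using that w(2)[of z] by (auto simp: frontier_cball)
  qed (use \<rho> in auto)
  moreover have "m ^ N \<le> cmod (G (of_real \<rho>))"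
  proof -
    have "(\<Prod>j<N. m) \<le> (\<Prod>j<N. cmod (g (of_real \<rho> * \<omega> ^ j)))"
      using m \<rho> by (intro prod_mono) (auto simp: norm_mult norm_power \<omega>)
    then show ?thesis by (simp add: G_def prod_norm)
  qed
  ultimately show ?thesis
    using that[of w] w(1) by (auto simp: G_def prod_norm)
qed

text \<open>Discrete form of the subharmonicity of \<open>ln |g|^2\<close>. On each circle the mean
  of \<open>u\<close> over \<open>N\<close> equally spaced points is at least
  \<open>ln (m\<^sup>2)\<close> for one starting point \<open>w\<close>; for large \<open>N\<close>,
  uniform continuity extends this to every starting point \<open>z\<close> with error
  \<open>\<epsilon>\<close>. Integrating over \<open>z\<close>, rotation invariance makes all
  \<open>N\<close> terms equal. The summand \<open>\<delta>\<close> keeps \<open>u\<close>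
  continuous at the zeros of \<open>g\<close>.\<close>

lemma set_integral_annulus_ln_ge:
  assumes g: "g holomorphic_on ball 0 1"
    and \<rho>: "0 \<le> \<rho>" "\<rho> \<le> r" "R < 1" and m: "0 < m" "\<And>z. cmod z = \<rho> \<Longrightarrow> m \<le> cmod (g z)"
    and \<delta>: "0 < \<delta>"
  shows "measure lborel (annulus r R) * ln (m\<^sup>2)
    \<le> (LINT z:annulus r R|lborel. ln ((cmod (g z))\<^sup>2 + \<delta>))"
proof -
  define A where "A = annulus r R"
  define u where "u = (\<lambda>z. ln ((cmod (g z))\<^sup>2 + \<delta>))"
  have pos: "0 < (cmod (g z))\<^sup>2 + \<delta>" for z
    using \<delta> by (simp add: add_nonneg_pos)
  have sub: "cball 0 R \<subseteq> ball (0::complex) 1" using \<rho> by auto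
  have contg: "continuous_on (cball 0 R) g"
    using holomorphic_on_imp_continuous_on[OF holomorphic_on_subset[OF g sub]] .
  have contu: "continuous_on (cball 0 R) u"
    unfolding u_def using pos by (intro continuous_intros contg) (auto simp: less_le)
  have contA: "continuous_on A u"
    using contu by (rule continuous_on_subset) (auto simp: A_def annulus_eq)
  have bound: "measure lborel A * (ln (m\<^sup>2) - \<epsilon>) \<le> (LINT z:A|lborel. u z)" if \<epsilon>: "0 < \<epsilon>" for \<epsilon>
  proof -
    have "uniformly_continuous_on (cball 0 R) u"
      by (rule compact_uniformly_continuous[OF contu]) simp
    then obtain d where d: "0 < d" "\<And>x y. x \<in> cball 0 R \<Longrightarrow> y \<in> cball 0 R \<Longrightarrow> dist y x < d \<Longrightarrow> dist (u y) (u x) < \<epsilon>"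
      using \<epsilon> unfolding uniformly_continuous_on_def by metis
    \<comment> \<open>The spacing \<open>2 * pi / N\<close> of the roots of unity has to stay below
      the modulus of continuity \<open>d\<close>.\<close>
    obtain N :: nat where N: "2 * pi / d < real N" using reals_Archimedean2 by blast
    have N0: "0 < N" using N d(1) by (metis divide_pos_pos gr0I mult_pos_pos of_nat_0 order_less_asym pi_gt_zero zero_less_numeral)
    have Nd: "2 * pi / real N < d" using N N0 d(1) by (simp add: field_simps)
    define \<omega> where "\<omega> = cis (2 * pi / real N)"
    have \<omega>1: "cmod \<omega> = 1" by (simp add: \<omega>_def)
    have \<omega>N: "\<omega> ^ N = 1" unfolding \<omega>_def Complex.DeMoivre using N0 by simp
    have pt: "real N * (ln (m\<^sup>2) - \<epsilon>) \<le> (\<Sum>j<N. u (z * \<omega> ^ j))" if z: "z \<in> A" for z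
    proof -
      define s where "s = cmod z"
      have s: "\<rho> \<le> s" "s \<le> R" using z \<rho> by (auto simp: s_def A_def annulus_def)
      then have s1: "s < 1" using \<rho> by simp
      obtain w where w: "cmod w = s" "m ^ N \<le> (\<Prod>j<N. cmod (g (w * \<omega> ^ j)))"
        by (rule exists_root_mean_ge[OF g \<rho>(1) s(1) s1 m \<omega>1 N0])
      have "real N * ln (m\<^sup>2) = ln ((m ^ N)\<^sup>2)"
        using m(1) by (simp add: ln_realpow)
      also have "\<dots> \<le> ln (\<Prod>j<N. ((cmod (g (w * \<omega> ^ j)))\<^sup>2 + \<delta>))"
      proof (subst ln_le_cancel_iff)
        have "(m ^ N)\<^sup>2 \<le> (\<Prod>j<N. cmod (g (w * \<omega> ^ j)))\<^sup>2"
          using w(2) m(1) by (intro power_mono) auto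
        also have "\<dots> = (\<Prod>j<N. (cmod (g (w * \<omega> ^ j)))\<^sup>2)"
          by (simp add: prod_power_distrib)
        also have "\<dots> \<le> (\<Prod>j<N. ((cmod (g (w * \<omega> ^ j)))\<^sup>2 + \<delta>))"
          using \<delta> by (intro prod_mono) auto
        finally show "(m ^ N)\<^sup>2 \<le> (\<Prod>j<N. ((cmod (g (w * \<omega> ^ j)))\<^sup>2 + \<delta>))" .
      qed (use m(1) pos in \<open>auto intro!: prod_pos\<close>)
      also have "\<dots> = (\<Sum>j<N. u (w * \<omega> ^ j))"
        unfolding u_def by (intro ln_prod) (use less_imp_neq[OF pos] in fastforce)+
      finally have mean_w: "real N * ln (m\<^sup>2) \<le> (\<Sum>j<N. u (w * \<omega> ^ j))" .
      show ?thesis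
      proof -
        obtain \<alpha> where \<alpha>: "0 \<le> \<alpha>" "\<alpha> < 2 * pi" "w = z * cis \<alpha>"
        proof (cases "s = 0")
          case True
          then show ?thesis using that[of 0] w(1) s_def by auto
        next
          case False
          then have "cmod (w / z) = 1" using w(1) by (simp add: s_def norm_divide)
          then obtain \<alpha> where "0 \<le> \<alpha>" "\<alpha> < 2 * pi" "w / z = Complex (cos \<alpha>) (sin \<alpha>)"
            by (rule complex_unimodular_polar)
          then have "0 \<le> \<alpha>" "\<alpha> < 2 * pi" "w / z = cis \<alpha>"
            by (simp_all add: complex_eq_iff)
          then show ?thesis using that[of \<alpha>] False by (auto simp: field_simps s_def)
        qed
        \<comment> \<open>The angle \<open>\<alpha>\<close> from \<open>z\<close> to
          \<open>w\<close> consists of \<open>i\<close> full steps and a remainder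
          \<open>\<phi>\<close> below one step. Full steps only permute the \<open>N\<close> points
          on the circle cyclically; the remainder moves each of them by less than
          \<open>d\<close>.\<close>
        define i where "i = nat \<lfloor>\<alpha> * real N / (2 * pi)\<rfloor>"
        define \<phi> where "\<phi> = \<alpha> - 2 * pi / real N * real i"
        have q0: "0 \<le> \<alpha> * real N / (2 * pi)" using \<alpha> by simp
        have i: "real i \<le> \<alpha> * real N / (2 * pi)" "\<alpha> * real N / (2 * pi) < real i + 1"
          unfolding i_def using q0 by linarith+
        then have \<phi>: "0 \<le> \<phi>" "\<phi> < 2 * pi / real N"
        proof -
          have "2 * pi / real N * (\<alpha> * real N / (2 * pi)) = \<alpha>" using N0 by simp
          moreover have "2 * pi / real N * real i \<le> 2 * pi / real N * (\<alpha> * real N / (2 * pi))"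
            using i(1) by (intro mult_left_mono) auto
          moreover have "2 * pi / real N * (\<alpha> * real N / (2 * pi)) < 2 * pi / real N * (real i + 1)"
            using i(2) N0 by (intro mult_strict_left_mono) auto
          ultimately show "0 \<le> \<phi>" "\<phi> < 2 * pi / real N"
            by (simp_all add: \<phi>_def distrib_left)
        qed
        have w\<phi>: "w = z * \<omega> ^ i * cis \<phi>"
        proof -
          have "\<omega> ^ i * cis \<phi> = cis (real i * (2 * pi / real N) + \<phi>)"
            unfolding \<omega>_def Complex.DeMoivre by (rule cis_mult)
          also have "real i * (2 * pi / real N) + \<phi> = \<alpha>" by (simp add: \<phi>_def)
          finally show ?thesis by (simp add: \<alpha>(3) mult.assoc)
        qed
        have "\<bar>\<phi>\<bar> < d" using \<phi> Nd by simp
        have close: "u (w * \<omega> ^ j) \<le> u (z * \<omega> ^ (i + j)) + \<epsilon>" for j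
        proof -
          have "dist (w * \<omega> ^ j) (z * \<omega> ^ (i + j)) = cmod (z * \<omega> ^ (i + j) * (cis \<phi> - 1))"
            by (simp add: dist_norm w\<phi> algebra_simps power_add)
          also have "\<dots> = s * cmod (cis \<phi> - 1)"
            by (simp add: norm_mult norm_power \<omega>1 s_def)
          also have "\<dots> \<le> 1 * \<bar>\<phi>\<bar>"
          proof (intro mult_mono)
            show "cmod (cis \<phi> - 1) \<le> \<bar>\<phi>\<bar>"
              using norm_exp_i_times [of \<phi>] dist_exp_i_1[of \<phi>] abs_sin_x_le_abs_x[of "\<phi>/2"]
              by (simp add: cis_conv_exp)
          qed (use s1 s \<rho> in auto)
          finally have "dist (w * \<omega> ^ j) (z * \<omega> ^ (i + j)) < d" using \<open>\<bar>\<phi>\<bar> < d\<close> by simp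
          then have "dist (u (w * \<omega> ^ j)) (u (z * \<omega> ^ (i + j))) < \<epsilon>"
            using s w(1) by (intro d(2)) (auto simp: norm_mult norm_power \<omega>1 s_def)
          then show ?thesis by (auto simp: dist_real_def)
        qed
        have "real N * ln (m\<^sup>2) \<le> (\<Sum>j<N. u (z * \<omega> ^ (i + j)) + \<epsilon>)"
          using mean_w sum_mono[of "{..<N}" "\<lambda>j. u (w * \<omega> ^ j)", OF close] by simp
        also have "\<dots> = (\<Sum>j<N. u (z * \<omega> ^ (i + j))) + real N * \<epsilon>"
          by (simp add: sum.distrib)
        also have "(\<Sum>j<N. u (z * \<omega> ^ (i + j))) = (\<Sum>j<N. u (z * \<omega> ^ j))"
          by (rule sum_cyclic_shift[of "\<lambda>j. u (z * \<omega> ^ j)"]) (simp add: power_add \<omega>N)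
        finally show ?thesis by (simp add: algebra_simps)
      qed
    qed
    have contj: "continuous_on A (\<lambda>z. u (z * \<omega> ^ j))" for j
      by (rule continuous_on_compose2[OF contA])
         (auto intro!: continuous_intros simp: A_def annulus_def norm_mult norm_power \<omega>1)
    have intj: "set_integrable lborel A (\<lambda>z. u (z * \<omega> ^ j))" for j
      unfolding A_def by (rule set_integrable_annulus[OF contj[unfolded A_def]])
    have "measure lborel A * (real N * (ln (m\<^sup>2) - \<epsilon>)) = (LINT z:A|lborel. real N * (ln (m\<^sup>2) - \<epsilon>))"
      using emeasure_annulus_finite[of r R] by (subst set_integral_const) (auto simp: A_def)
    also have "\<dots> \<le> (LINT z:A|lborel. (\<Sum>j<N. u (z * \<omega> ^ j)))"
    proof (rule set_integral_mono[OF _ _ pt])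
      show "set_integrable lborel A (\<lambda>z. real N * (ln (m\<^sup>2) - \<epsilon>))"
        unfolding A_def by (intro set_integrable_annulus continuous_intros)
      show "set_integrable lborel A (\<lambda>z. \<Sum>j<N. u (z * \<omega> ^ j))"
        unfolding A_def by (intro set_integrable_annulus continuous_intros contj[unfolded A_def])
    qed
    also have "\<dots> = (\<Sum>j<N. LINT z:A|lborel. u (z * \<omega> ^ j))"
      unfolding set_lebesgue_integral_def scaleR_sum_right
      using intj by (intro Bochner_Integration.integral_sum) (simp add: set_integrable_def)
    also have "\<dots> = (\<Sum>j<N. LINT z:A|lborel. u z)"
      using contA by (intro sum.cong refl) (simp add: A_def set_integral_annulus_rotate norm_power \<omega>1)
    also have "\<dots> = real N * (LINT z:A|lborel. u z)" by simp
    finally have "real N * (measure lborel A * (ln (m\<^sup>2) - \<epsilon>)) \<le> real N * (LINT z:A|lborel. u z)"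
      by (simp add: mult.left_commute)
    then show ?thesis using N0 by simp
  qed
  have "measure lborel A * ln (m\<^sup>2) \<le> (LINT z:A|lborel. u z)"
  proof (rule field_le_epsilon)
    fix e :: real assume e: "0 < e"
    \<comment> \<open>The \<open>+ 1\<close> keeps the divisor positive when the annulus is a null
      set.\<close>
    define \<epsilon> where "\<epsilon> = e / (measure lborel A + 1)"
    have "0 < \<epsilon>" using e by (simp add: \<epsilon>_def add_nonneg_pos)
    have "0 < measure lborel A + 1" by (simp add: add_nonneg_pos)
    then have "(measure lborel A + 1) * \<epsilon> = e" by (simp add: \<epsilon>_def)
    then have "measure lborel A * \<epsilon> \<le> e" using \<open>0 < \<epsilon>\<close> by (simp add: distrib_right)
    with bound[OF \<open>0 < \<epsilon>\<close>] show "measure lborel A * ln (m\<^sup>2) \<le> (LINT z:A|lborel. u z) + e"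
      by (simp add: algebra_simps)
  qed
  then show ?thesis by (simp add: A_def u_def)
qed

subsection \<open>A logarithmic defect\<close>

text \<open>Up to the factor \<open>2 ln 2\<close>, this bounds the negative part of \<open>ln (x\<^sup>2)\<close>; unlike the
  latter, whose junk value at \<open>0\<close> is \<open>0\<close>, it is infinite at \<open>0\<close>.\<close>

definition log_defect :: "real \<Rightarrow> ennreal" where
  "log_defect x = (\<Sum>n. indicator {y. \<bar>y\<bar> < 1 / 2 ^ n} x)"

lemma log_defect_measurable [measurable]: "log_defect \<in> borel_measurable borel"
  unfolding log_defect_def by measurable

lemma log_defect_ge:
  assumes "\<And>n. n < K \<Longrightarrow> \<bar>x\<bar> < 1 / 2 ^ n"
  shows "of_nat K \<le> log_defect x"
proof -
  have "of_nat K = (\<Sum>n<K. indicator {y. \<bar>y\<bar> < 1 / 2 ^ n} x :: ennreal)"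
    using assms by (simp add: indicator_def)
  also have "\<dots> \<le> log_defect x"
    unfolding log_defect_def by (rule sum_le_suminf) auto
  finally show ?thesis .
qed

text \<open>\<open>log_defect x\<close> counts the \<open>n\<close> with
  \<open>n < - ln |x| / ln 2\<close>, so it is at least that bound, while
  \<open>- ln y \<le> - 2 * ln |x|\<close>. At \<open>x = 0\<close> the count is infinite and
  dominates every real \<open>a\<close>.\<close>

lemma minus_ln_le_log_defect:
  assumes "x\<^sup>2 \<le> y" "0 < y"
  shows "ennreal (- ln y) \<le> ennreal (2 * ln 2) * log_defect x"
proof -
  have bound: "ennreal (2 * ln 2 * a) \<le> ennreal (2 * ln 2) * log_defect x"
    if "x = 0 \<or> a \<le> - ln \<bar>x\<bar> / ln 2" for a
  proof -
    define K where "K = nat \<lceil>a\<rceil>"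
    have "of_nat K \<le> log_defect x"
    proof (rule log_defect_ge)
      fix n assume "n < K"
      show "\<bar>x\<bar> < 1 / 2 ^ n"
      proof (cases "x = 0")
        case False
        from \<open>n < K\<close> have "real n < a" unfolding K_def by linarith
        with that False have "real n < - ln \<bar>x\<bar> / ln 2" by simp
        then have "ln \<bar>x\<bar> < - (real n * ln 2)" by (simp add: field_simps)
        also have "\<dots> = ln (1 / 2 ^ n)" by (simp add: ln_div ln_realpow)
        finally show ?thesis using False by simp
      qed simp
    qed
    moreover have "ennreal a \<le> of_nat K"
      unfolding K_def ennreal_of_nat_eq_real_of_nat by (intro ennreal_leI) linarith
    ultimately have "ennreal a \<le> log_defect x" by (rule order.trans[rotated])
    then have "ennreal (2 * ln 2) * ennreal a \<le> ennreal (2 * ln 2) * log_defect x"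
      by (intro mult_left_mono) auto
    then show ?thesis by (subst ennreal_mult') auto
  qed
  have "ln y \<ge> 2 * ln \<bar>x\<bar>" if "x \<noteq> 0"
  proof -
    have "2 * ln \<bar>x\<bar> = ln (\<bar>x\<bar>\<^sup>2)" using that by (simp only: ln_realpow)
    also have "\<dots> \<le> ln y" using assms that by simp
    finally show ?thesis .
  qed
  then have "x = 0 \<or> - ln y / (2 * ln 2) \<le> - ln \<bar>x\<bar> / ln 2"
    by (auto simp: field_simps)
  from bound[OF this] show ?thesis by simp
qed

section \<open>A lower bound for the integral of \<open>|f g|^2\<close> over an annulus\<close>

text \<open>For the Gaussian series, \<open>F z\<close> has variance \<open>1 / (1 - |z|^2)\<close>;
  the square root gives the argument of \<open>log_defect\<close> the same law at every
  \<open>z\<close>. Passing to the real part is harmless for lower bounds, since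
  \<open>|Re (F z)| \<le> |F z|\<close>, and leaves a real Gaussian.\<close>

definition annulus_defect :: "real \<Rightarrow> real \<Rightarrow> (complex \<Rightarrow> complex) \<Rightarrow> ennreal" where
  "annulus_defect r R F =
     (\<integral>\<^sup>+z\<in>annulus r R. log_defect (sqrt (1 - (cmod z)\<^sup>2) * Re (F z)) \<partial>lborel)"

text \<open>By Jensen's inequality the mean of \<open>|f g|^2\<close> is at least the exponential of
  the mean of \<open>ln |f|^2 + ln |g|^2\<close>. The \<open>g\<close> part is at least
  \<open>ln (m\<^sup>2)\<close>, and the defect bounds the \<open>f\<close> part from below by
  \<open>- 2 * ln 2 * C - ln (1 - r\<^sup>2)\<close>. The logarithms are regularised by
  \<open>\<delta>\<close> and \<open>\<eta>\<close>, and \<open>\<eta>\<close> tends to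
  \<open>0\<close> at the end.\<close>

lemma annulus_norm_integral_ge:
  assumes f: "f holomorphic_on ball 0 1" and g: "g holomorphic_on ball 0 1"
    and \<rho>: "0 \<le> \<rho>" "\<rho> \<le> r" "r < R" "R < 1" and m: "0 < m" "\<And>z. cmod z = \<rho> \<Longrightarrow> m \<le> cmod (g z)"
    and C: "0 \<le> C" "annulus_defect r R f \<le> ennreal (C * measure lborel (annulus r R))"
  shows "measure lborel (annulus r R) * (m\<^sup>2 * exp (- (2 * ln 2 * C)) / (1 - r\<^sup>2))
    \<le> (LINT z:annulus r R|lborel. (cmod (f z * g z))\<^sup>2)"
proof -
  define A where "A = annulus r R"
  define a where "a = measure lborel A"
  have r1: "0 < 1 - r\<^sup>2" using \<rho> by (simp add: power_less_one_iff abs_square_less_1)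
  have a0: "0 < a"
    unfolding a_def A_def using \<rho> by (simp add: measure_annulus power_strict_mono)
  have sub: "A \<subseteq> ball (0::complex) 1" using \<rho> by (auto simp: A_def annulus_def)
  have contf: "continuous_on A f" and contg: "continuous_on A g"
    using f g sub holomorphic_on_imp_continuous_on holomorphic_on_subset by metis+
  have int: "set_integrable lborel A u" if "continuous_on A u" for u :: "complex \<Rightarrow> real"
    using that set_integrable_annulus unfolding A_def by blast
  have const: "(LINT z:A|lborel. c) = a * c" for c :: real
    using emeasure_annulus_finite[of r R] by (subst set_integral_const) (auto simp: A_def a_def)
  have [measurable]: "A \<in> sets borel" by (simp add: A_def)
  define I where "I = (LINT z:A|lborel. (cmod (f z * g z))\<^sup>2)"
  have I0: "0 \<le> I"
    unfolding I_def set_lebesgue_integral_def by (intro integral_nonneg_AE) auto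
  have eta: "m\<^sup>2 * exp (- (2 * ln 2 * C)) / (1 - r\<^sup>2) \<le> I / a + \<eta>" if \<eta>: "0 < \<eta>" for \<eta>
  proof -
    obtain B where B: "\<And>z. z \<in> A \<Longrightarrow> (cmod (f z))\<^sup>2 \<le> B" "\<And>z. z \<in> A \<Longrightarrow> (cmod (g z))\<^sup>2 \<le> B" "0 \<le> B"
    proof -
      have "compact ((\<lambda>z. (cmod (f z))\<^sup>2 + (cmod (g z))\<^sup>2) ` A)"
        unfolding A_def by (intro compact_continuous_image compact_annulus continuous_intros contf[unfolded A_def] contg[unfolded A_def])
      then obtain B where "\<And>z. z \<in> A \<Longrightarrow> norm ((cmod (f z))\<^sup>2 + (cmod (g z))\<^sup>2) \<le> B"
        by (meson bounded_iff compact_imp_bounded imageI)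
      then have B': "(cmod (f z))\<^sup>2 + (cmod (g z))\<^sup>2 \<le> B" if "z \<in> A" for z
        using that by fastforce
      show ?thesis
      proof (rule that[of "max B 0"])
        fix z assume "z \<in> A"
        have "(cmod (f z))\<^sup>2 \<ge> 0" "(cmod (g z))\<^sup>2 \<ge> 0" by auto
        with B'[OF \<open>z \<in> A\<close>] show "(cmod (f z))\<^sup>2 \<le> max B 0" "(cmod (g z))\<^sup>2 \<le> max B 0" by linarith+
      qed simp
    qed
    \<comment> \<open>Chosen so that the terms containing \<open>\<delta>\<close> in
      \<open>(|f|^2 + \<delta>) * (|g|^2 + \<delta>)\<close> add up to at most \<open>\<eta>\<close>
      on \<open>A\<close>.\<close>
    define \<delta> where "\<delta> = min 1 (\<eta> / (2 * B + 1))"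
    have \<delta>: "0 < \<delta>" "\<delta> \<le> 1" using \<eta> B(3) by (auto simp: \<delta>_def)
    have "\<delta> * (2 * B + 1) \<le> \<eta> / (2 * B + 1) * (2 * B + 1)"
      using B(3) by (intro mult_right_mono) (auto simp: \<delta>_def)
    then have \<delta>B: "\<delta> * (2 * B + 1) \<le> \<eta>" using B(3) by simp
    have posf: "0 < (cmod (f z))\<^sup>2 + \<delta>" and posg: "0 < (cmod (g z))\<^sup>2 + \<delta>" for z
      using \<delta> by (simp_all add: add_nonneg_pos)
    have posh: "0 < (cmod (f z * g z))\<^sup>2 + \<eta>" for z
      using \<eta> by (simp add: add_nonneg_pos)
    have c1: "continuous_on A (\<lambda>z. ln ((cmod (f z))\<^sup>2 + \<delta>))"
      and c2: "continuous_on A (\<lambda>z. ln ((cmod (g z))\<^sup>2 + \<delta>))"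
      and c3: "continuous_on A (\<lambda>z. ln ((cmod (f z * g z))\<^sup>2 + \<eta>))"
      using posf posg posh by (intro continuous_intros contf contg; simp add: less_le)+
    \<comment> \<open>\<open>\<mu>\<close> is the mean of \<open>|f g|^2 + \<eta>\<close>. Jensen's
      inequality comes from integrating the tangent bound
      \<open>ln x \<le> x / \<mu> - 1 + ln \<mu>\<close>, whose right side has mean exactly
      \<open>ln \<mu>\<close>.\<close>
    define \<mu> where "\<mu> = I / a + \<eta>"
    have \<mu>: "0 < \<mu>" using I0 a0 \<eta> by (simp add: \<mu>_def add_nonneg_pos)
    have "(LINT z:A|lborel. ln ((cmod (f z))\<^sup>2 + \<delta>)) + (LINT z:A|lborel. ln ((cmod (g z))\<^sup>2 + \<delta>))
        = (LINT z:A|lborel. ln ((cmod (f z))\<^sup>2 + \<delta>) + ln ((cmod (g z))\<^sup>2 + \<delta>))"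
      by (rule set_integral_add(2)[OF int[OF c1] int[OF c2], symmetric])
    also have "\<dots> \<le> (LINT z:A|lborel. ln ((cmod (f z * g z))\<^sup>2 + \<eta>))"
    proof (rule set_integral_mono[OF set_integral_add(1)[OF int[OF c1] int[OF c2]] int[OF c3]])
      fix z assume z: "z \<in> A"
      have "((cmod (f z))\<^sup>2 + \<delta>) * ((cmod (g z))\<^sup>2 + \<delta>)
          = (cmod (f z * g z))\<^sup>2 + \<delta> * ((cmod (f z))\<^sup>2 + (cmod (g z))\<^sup>2 + \<delta>)"
        by (simp add: norm_mult power_mult_distrib algebra_simps)
      also have "\<delta> * ((cmod (f z))\<^sup>2 + (cmod (g z))\<^sup>2 + \<delta>) \<le> \<delta> * (2 * B + 1)"
        using \<delta> B(1)[OF z] B(2)[OF z] by (intro mult_left_mono) auto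
      finally have "((cmod (f z))\<^sup>2 + \<delta>) * ((cmod (g z))\<^sup>2 + \<delta>) \<le> (cmod (f z * g z))\<^sup>2 + \<eta>"
        using \<delta>B by simp
      moreover have "ln ((cmod (f z))\<^sup>2 + \<delta>) + ln ((cmod (g z))\<^sup>2 + \<delta>)
          = ln (((cmod (f z))\<^sup>2 + \<delta>) * ((cmod (g z))\<^sup>2 + \<delta>))"
        using posf[of z] posg[of z] by (simp add: ln_mult)
      ultimately show "ln ((cmod (f z))\<^sup>2 + \<delta>) + ln ((cmod (g z))\<^sup>2 + \<delta>) \<le> ln ((cmod (f z * g z))\<^sup>2 + \<eta>)"
        using posf[of z] posg[of z] posh[of z] by (simp add: ln_le_cancel_iff)
    qed
    also have "\<dots> \<le> (LINT z:A|lborel. (cmod (f z * g z))\<^sup>2 / \<mu> + (\<eta> / \<mu> - 1 + ln \<mu>))"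
    proof (rule set_integral_mono[OF int[OF c3]])
      show "set_integrable lborel A (\<lambda>z. (cmod (f z * g z))\<^sup>2 / \<mu> + (\<eta> / \<mu> - 1 + ln \<mu>))"
        using \<mu> by (intro int continuous_intros contf contg) auto
      fix z
      have "ln (((cmod (f z * g z))\<^sup>2 + \<eta>) / \<mu>) \<le> ((cmod (f z * g z))\<^sup>2 + \<eta>) / \<mu> - 1"
        using posh \<mu> by (intro ln_le_minus_one) auto
      moreover have "ln (((cmod (f z * g z))\<^sup>2 + \<eta>) / \<mu>) = ln ((cmod (f z * g z))\<^sup>2 + \<eta>) - ln \<mu>"
        using posh[of z] \<mu> by (simp add: ln_div)
      ultimately show "ln ((cmod (f z * g z))\<^sup>2 + \<eta>) \<le> (cmod (f z * g z))\<^sup>2 / \<mu> + (\<eta> / \<mu> - 1 + ln \<mu>)"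
        by (simp add: add_divide_distrib)
    qed
    also have "\<dots> = (LINT z:A|lborel. (cmod (f z * g z))\<^sup>2 / \<mu>) + (LINT z:A|lborel. \<eta> / \<mu> - 1 + ln \<mu>)"
      using \<mu> by (intro set_integral_add(2) int continuous_intros contf contg) auto
    also have "\<dots> = I / \<mu> + a * (\<eta> / \<mu> - 1 + ln \<mu>)"
      by (simp only: const set_integral_divide_zero I_def)
    also have "\<dots> = a * ln \<mu>"
    proof -
      have "I + a * \<eta> = a * \<mu>" using a0 by (simp add: \<mu>_def distrib_left)
      then have "I / \<mu> + a * (\<eta> / \<mu>) = a" using \<mu> by (simp add: field_simps)
      then show ?thesis by (simp add: algebra_simps)
    qed
    finally have upper: "(LINT z:A|lborel. ln ((cmod (f z))\<^sup>2 + \<delta>)) + (LINT z:A|lborel. ln ((cmod (g z))\<^sup>2 + \<delta>)) \<le> a * ln \<mu>" .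
    have lower_g: "a * ln (m\<^sup>2) \<le> (LINT z:A|lborel. ln ((cmod (g z))\<^sup>2 + \<delta>))"
      unfolding a_def A_def using set_integral_annulus_ln_ge[OF g \<rho>(1,2,4) m \<delta>(1)] .
    have lower_f: "- (2 * ln 2 * C * a) - a * ln (1 - r\<^sup>2) \<le> (LINT z:A|lborel. ln ((cmod (f z))\<^sup>2 + \<delta>))"
    proof -
      \<comment> \<open>On the annulus \<open>1 - r\<^sup>2\<close> dominates
        \<open>1 - |z|^2\<close>, so the defect of the normalised real part controls the negative
        part \<open>p\<close> of \<open>v\<close>. Splitting off the constant
        \<open>ln (1 - r\<^sup>2)\<close> later yields the factor
        \<open>1 / (1 - r\<^sup>2)\<close>.\<close>
      define v where "v = (\<lambda>z. ln ((cmod (f z))\<^sup>2 + \<delta>) + ln (1 - r\<^sup>2))"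
      define p where "p = (\<lambda>z. max 0 (- v z))"
      have contv: "continuous_on A v" unfolding v_def by (intro continuous_intros c1)
      have contp: "continuous_on A p" unfolding p_def by (intro continuous_intros contv)
      have pb: "ennreal (p z) \<le> ennreal (2 * ln 2) * log_defect (sqrt (1 - (cmod z)\<^sup>2) * Re (f z))" if z: "z \<in> A" for z
      proof -
        have zz: "r\<^sup>2 \<le> (cmod z)\<^sup>2" "(cmod z)\<^sup>2 \<le> 1"
        proof -
          have "0 \<le> r" "r \<le> cmod z" "cmod z \<le> 1" using z \<rho> by (auto simp: A_def annulus_def)
          then show "r\<^sup>2 \<le> (cmod z)\<^sup>2" "(cmod z)\<^sup>2 \<le> 1"
            by (auto intro: power_mono power_le_one)
        qed
        have "(sqrt (1 - (cmod z)\<^sup>2) * Re (f z))\<^sup>2 = (1 - (cmod z)\<^sup>2) * (Re (f z))\<^sup>2"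
          using zz by (simp add: power_mult_distrib)
        also have "\<dots> \<le> (1 - r\<^sup>2) * ((cmod (f z))\<^sup>2 + \<delta>)"
        proof (intro mult_mono)
          show "(Re (f z))\<^sup>2 \<le> (cmod (f z))\<^sup>2 + \<delta>" using \<delta> by (simp add: cmod_power2)
        qed (use zz r1 in auto)
        finally have "(sqrt (1 - (cmod z)\<^sup>2) * Re (f z))\<^sup>2 \<le> (1 - r\<^sup>2) * ((cmod (f z))\<^sup>2 + \<delta>)" .
        from minus_ln_le_log_defect[OF this] r1 posf
        have "ennreal (- ln ((1 - r\<^sup>2) * ((cmod (f z))\<^sup>2 + \<delta>)))
          \<le> ennreal (2 * ln 2) * log_defect (sqrt (1 - (cmod z)\<^sup>2) * Re (f z))" by simp
        moreover have "ln ((1 - r\<^sup>2) * ((cmod (f z))\<^sup>2 + \<delta>)) = v z"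
          using r1 posf[of z] by (simp add: v_def ln_mult)
        ultimately show ?thesis
          by (simp add: p_def max_def ennreal_neg)
      qed
      have "ennreal (LINT z:A|lborel. p z) = (\<integral>\<^sup>+z. ennreal (indicator A z *\<^sub>R p z) \<partial>lborel)"
        unfolding set_lebesgue_integral_def
        by (rule nn_integral_eq_integral[symmetric]) (use int[OF contp] in \<open>auto simp: set_integrable_def p_def\<close>)
      also have "\<dots> \<le> (\<integral>\<^sup>+z. ennreal (2 * ln 2) * (log_defect (sqrt (1 - (cmod z)\<^sup>2) * Re (f z)) * indicator A z) \<partial>lborel)"
        by (intro nn_integral_mono) (auto simp: indicator_def pb)
      also have "\<dots> = ennreal (2 * ln 2) * annulus_defect r R f"
      proof -
        \<comment> \<open>\<open>f\<close> is known to be continuous only on \<open>A\<close>, so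
          measurability is obtained for its extension by zero; the indicator makes the integrands
          agree.\<close>
        have [measurable]: "(\<lambda>z. indicator A z *\<^sub>R f z) \<in> borel_measurable borel"
          using borel_measurable_continuous_on_indicator[OF _ contf] by simp
        have eq: "log_defect (sqrt (1 - (cmod z)\<^sup>2) * Re (f z)) * indicator A z
            = log_defect (sqrt (1 - (cmod z)\<^sup>2) * Re (indicator A z *\<^sub>R f z)) * indicator A z" for z
          by (auto simp: indicator_def)
        show ?thesis
          unfolding annulus_defect_def A_def[symmetric] eq by (rule nn_integral_cmult) measurable
      qed
      also have "\<dots> \<le> ennreal (2 * ln 2) * ennreal (C * a)"
        using C(2) by (intro mult_left_mono) (auto simp: a_def A_def)
      also have "\<dots> = ennreal (2 * ln 2 * C * a)"
        using a0 C by (simp add: ennreal_mult'[symmetric] mult.assoc)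
      finally have "(LINT z:A|lborel. p z) \<le> 2 * ln 2 * C * a"
        using a0 C by (subst (asm) ennreal_le_iff) auto
      moreover have "- (LINT z:A|lborel. p z) \<le> (LINT z:A|lborel. v z)"
      proof -
        have "(LINT z:A|lborel. - p z) \<le> (LINT z:A|lborel. v z)"
          by (intro set_integral_mono int continuous_intros contp contv) (auto simp: p_def)
        then show ?thesis by (simp add: set_lebesgue_integral_def)
      qed
      moreover have "(LINT z:A|lborel. v z) = (LINT z:A|lborel. ln ((cmod (f z))\<^sup>2 + \<delta>)) + a * ln (1 - r\<^sup>2)"
        unfolding v_def using c1 by (subst set_integral_add(2)) (auto intro!: int simp: const)
      ultimately show ?thesis by linarith
    qed
    have "a * (ln (m\<^sup>2) - 2 * ln 2 * C - ln (1 - r\<^sup>2)) \<le> a * ln \<mu>"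
      using upper lower_f lower_g by (simp add: algebra_simps)
    then have "ln (m\<^sup>2) - 2 * ln 2 * C - ln (1 - r\<^sup>2) \<le> ln \<mu>" using a0 by simp
    then have "exp (ln (m\<^sup>2) - 2 * ln 2 * C - ln (1 - r\<^sup>2)) \<le> \<mu>"
      using \<mu> by (metis exp_le_cancel_iff exp_ln)
    moreover have "exp (ln (m\<^sup>2) - 2 * ln 2 * C - ln (1 - r\<^sup>2)) = m\<^sup>2 * exp (- (2 * ln 2 * C)) / (1 - r\<^sup>2)"
      using m(1) r1 by (simp add: exp_diff exp_minus divide_inverse del: ln_realpow)
    ultimately show ?thesis by (simp add: \<mu>_def)
  qed
  have "m\<^sup>2 * exp (- (2 * ln 2 * C)) / (1 - r\<^sup>2) \<le> I / a"
    by (rule field_le_epsilon) (rule eta)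
  then show ?thesis
    using a0 unfolding I_def[symmetric] A_def[symmetric] a_def[symmetric] by (simp add: pos_le_divide_eq mult.commute)
qed

subsection \<open>The deterministic uniqueness criterion\<close>

text \<open>At a zero \<open>a\<close> of \<open>F\<close>, dividing \<open>h\<close> and
  \<open>F\<close> by \<open>z - a\<close> shows that \<open>h / F\<close> tends to
  \<open>deriv h a / deriv F a\<close>, which is finite because the zero is simple. The singularity
  is therefore removable.\<close>

lemma holomorphic_quotient_simple_zeros:
  assumes F: "F holomorphic_on S" and h: "h holomorphic_on S" and S: "open S"
    and simple: "\<And>z. z \<in> S \<Longrightarrow> F z = 0 \<Longrightarrow> deriv F z \<noteq> 0"
    and van: "\<And>z. z \<in> S \<Longrightarrow> F z = 0 \<Longrightarrow> h z = 0"
  obtains g where "g holomorphic_on S" "\<And>z. z \<in> S \<Longrightarrow> h z = F z * g z"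
proof -
  define g where "g = (\<lambda>z. if F z = 0 then deriv h z / deriv F z else h z / F z)"
  have local: "\<exists>e>0. ball a e \<subseteq> S \<and> g holomorphic_on ball a e" if a: "a \<in> S" for a
  proof (cases "F a = 0")
    case False
    have "continuous_on S F" using F by (rule holomorphic_on_imp_continuous_on)
    then have "open (F -` (- {0}) \<inter> S)"
      using S by (metis continuous_on_open_vimage open_Compl closed_singleton)
    moreover have "a \<in> F -` (- {0}) \<inter> S" using a False by simp
    ultimately obtain e where e: "0 < e" "ball a e \<subseteq> F -` (- {0}) \<inter> S"
      using openE by blast
    have "(\<lambda>z. h z / F z) holomorphic_on ball a e"
      using e by (intro holomorphic_intros holomorphic_on_subset[OF F] holomorphic_on_subset[OF h]) auto
    then have "g holomorphic_on ball a e"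
      by (rule holomorphic_transform) (use e in \<open>auto simp: g_def\<close>)
    then show ?thesis using e by auto
  next
    case True
    have dF: "(F has_field_derivative deriv F a) (at a)" and dh: "(h has_field_derivative deriv h a) (at a)"
      using F h S a by (auto intro: holomorphic_derivI)
    have limF: "((\<lambda>z. F z / (z - a)) \<longlongrightarrow> deriv F a) (at a)"
      and limh: "((\<lambda>z. h z / (z - a)) \<longlongrightarrow> deriv h a) (at a)"
      using dF dh True van[OF a True] by (simp_all add: has_field_derivative_iff)
    have "((\<lambda>z. (h z / (z - a)) / (F z / (z - a))) \<longlongrightarrow> deriv h a / deriv F a) (at a)"
      by (rule tendsto_divide[OF limh limF simple[OF a True]])
    moreover have nz: "eventually (\<lambda>z. F z / (z - a) \<noteq> 0) (at a)"
      using tendsto_imp_eventually_ne[OF limF simple[OF a True]] .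
    moreover have "eventually (\<lambda>z. (h z / (z - a)) / (F z / (z - a)) = g z) (at a)"
      using nz by eventually_elim (auto simp: g_def)
    ultimately have lim: "(g \<longlongrightarrow> g a) (at a)"
      using True by (simp add: g_def[of] tendsto_cong)
    have "eventually (\<lambda>z. z \<in> S) (at a)" using S a by (rule eventually_at_in_open')
    with nz have "eventually (\<lambda>z. F z \<noteq> 0 \<and> z \<in> S) (at a)"
      by eventually_elim auto
    then obtain e where e: "0 < e" "\<And>z. z \<noteq> a \<Longrightarrow> dist z a < e \<Longrightarrow> F z \<noteq> 0 \<and> z \<in> S"
      unfolding eventually_at by auto
    have sub: "ball a e \<subseteq> S"
    proof
      fix x assume "x \<in> ball a e"
      then show "x \<in> S" using e(2)[of x] a by (cases "x = a") (auto simp: dist_commute)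
    qed
    have "(\<lambda>z. h z / F z) holomorphic_on ball a e - {a}"
      using e sub by (intro holomorphic_intros holomorphic_on_subset[OF F] holomorphic_on_subset[OF h])
        (auto simp: dist_commute)
    then have "g holomorphic_on ball a e - {a}"
      by (rule holomorphic_transform) (use e in \<open>auto simp: g_def dist_commute\<close>)
    moreover have "(g \<longlongrightarrow> g z) (at z within ball a e)" if "z \<in> {a}" for z
      using lim that by (auto intro: tendsto_within_subset)
    ultimately have "g holomorphic_on ball a e"
      by - (rule no_isolated_singularity'[of "{a}" g "ball a e"], auto)
    then show ?thesis using e sub by auto
  qed
  have "g field_differentiable at a" if "a \<in> S" for a
  proof -
    obtain e where "0 < e" "g holomorphic_on ball a e" using local[OF \<open>a \<in> S\<close>] by blast
    then show ?thesis by (intro holomorphic_on_imp_differentiable_at[of g "ball a e"]) auto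
  qed
  then have "g holomorphic_on S"
    unfolding holomorphic_on_def by (auto intro: field_differentiable_at_within)
  moreover have "h z = F z * g z" if "z \<in> S" for z
    using van[OF that] by (auto simp: g_def)
  ultimately show ?thesis using that by blast
qed

section \<open>Dyadic annuli approaching the unit circle\<close>

text \<open>The \<open>Suc\<close> makes \<open>rad 0 = 1 / 2\<close>, so all annuli avoid the
  origin and start no earlier than the circle supplied by
  \<open>nonvanishing_circle\<close>.\<close>

definition rad :: "nat \<Rightarrow> real" where
  "rad k = 1 - 1 / 2 ^ Suc k"

lemma rad_bounds: "1 / 2 \<le> rad k" "rad k < rad (Suc k)" "rad k < 1"
  by (simp_all add: rad_def field_simps)

lemma rad_tendsto: "rad \<longlonglongrightarrow> 1"
proof -
  have "(\<lambda>k. 1 - (1 / 2) ^ Suc k) \<longlonglongrightarrow> (1 - 0 :: real)"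
    by (intro tendsto_intros LIMSEQ_Suc[OF LIMSEQ_power_zero]) auto
  then show ?thesis unfolding rad_def[abs_def] by (simp add: power_divide)
qed

text \<open>The area of the annulus is comparable to \<open>1 - r^2\<close>, which cancels the
  growth factor in \<open>annulus_norm_integral_ge\<close> and leaves a bound independent of
  \<open>k\<close>. With \<open>q = 1 / 2 ^ k\<close> the claim reduces to
  \<open>q\<^sup>2 \<le> q\<close>.\<close>

lemma measure_annulus_rad_ge:
  "pi / 4 \<le> measure lborel (annulus (rad k) (rad (Suc k))) / (1 - (rad k)\<^sup>2)"
proof -
  define q :: real where "q = 1 / 2 ^ k"
  have q: "0 < q" "q \<le> 1" by (simp_all add: q_def)
  have r: "rad k = 1 - q / 2" "rad (Suc k) = 1 - q / 4" by (simp_all add: rad_def q_def)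
  have "measure lborel (annulus (rad k) (rad (Suc k))) = pi * ((rad (Suc k))\<^sup>2 - (rad k)\<^sup>2)"
    using rad_bounds[of k] by (intro measure_annulus) auto
  also have "(rad (Suc k))\<^sup>2 - (rad k)\<^sup>2 = q / 2 - 3 * q\<^sup>2 / 16"
    by (simp add: r power2_eq_square algebra_simps)
  finally have M: "measure lborel (annulus (rad k) (rad (Suc k))) = pi * (q / 2 - 3 * q\<^sup>2 / 16)" .
  have D: "1 - (rad k)\<^sup>2 = q - q\<^sup>2 / 4"
    by (simp add: r power2_eq_square algebra_simps)
  have "q * q \<le> q * 1" using q by (intro mult_left_mono) auto
  then have q2: "q\<^sup>2 \<le> q" by (simp add: power2_eq_square)
  have "0 < q - q\<^sup>2 / 4" using q q2 by linarith
  moreover have "(q - q\<^sup>2 / 4) / 4 \<le> q / 2 - 3 * q\<^sup>2 / 16"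
    using q q2 by (simp add: field_simps)
  then have "pi * ((q - q\<^sup>2 / 4) / 4) \<le> pi * (q / 2 - 3 * q\<^sup>2 / 16)"
    by (intro mult_left_mono) auto
  ultimately show ?thesis
    unfolding M D by (simp add: pos_le_divide_eq)
qed

text \<open>Dominated convergence: each point of the disc leaves the annuli as soon as
  \<open>rad k\<close> exceeds its modulus, and \<open>|u|\<close> on the disc is the
  majorant.\<close>

lemma annulus_integral_tendsto_0:
  fixes u :: "complex \<Rightarrow> real"
  assumes u: "set_integrable lborel (ball 0 1) u"
  shows "(\<lambda>k. LINT z:annulus (rad k) (rad (Suc k))|lborel. u z) \<longlonglongrightarrow> 0"
proof -
  define A where "A = (\<lambda>k. annulus (rad k) (rad (Suc k)))"
  have sub: "A k \<subseteq> ball 0 1" for k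
    using rad_bounds(3)[of "Suc k"] by (auto simp: A_def annulus_def)
  have meas: "(\<lambda>z. indicator (ball 0 1) z *\<^sub>R u z) \<in> borel_measurable lborel"
    using u unfolding set_integrable_def by (rule borel_measurable_integrable)
  have eq: "indicator (A k) z *\<^sub>R u z = indicator (A k) z *\<^sub>R (indicator (ball 0 1) z *\<^sub>R u z)" for k z
    using sub[of k] by (auto simp: indicator_def)
  have "(\<lambda>k. LINT z|lborel. indicator (A k) z *\<^sub>R u z) \<longlonglongrightarrow> (LINT (z::complex)|lborel. 0)"
  proof (rule integral_dominated_convergence)
    show "integrable lborel (\<lambda>z. norm (indicator (ball 0 1) z *\<^sub>R u z))"
      using u unfolding set_integrable_def by (rule integrable_norm)
    show "(\<lambda>z. indicator (A k) z *\<^sub>R u z) \<in> borel_measurable lborel" for k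
      unfolding eq by (rule borel_measurable_scaleR[OF _ meas]) (simp add: A_def)
    show "AE z in lborel. (\<lambda>k. indicator (A k) z *\<^sub>R u z) \<longlonglongrightarrow> 0"
    proof (rule AE_I2)
      fix z :: complex
      have "eventually (\<lambda>k. indicator (A k) z *\<^sub>R u z = 0) sequentially"
      proof (cases "cmod z < 1")
        case True
        then have "eventually (\<lambda>k. cmod z < rad k) sequentially"
          using rad_tendsto by (rule order_tendstoD[rotated])
        then show ?thesis by eventually_elim (auto simp: A_def annulus_def)
      next
        case False
        then have "z \<notin> A k" for k using sub[of k] by auto
        then show ?thesis by simp
      qed
      then show "(\<lambda>k. indicator (A k) z *\<^sub>R u z) \<longlonglongrightarrow> 0"
        by (rule tendsto_eventually)
    qed
    show "AE z in lborel. norm (indicator (A k) z *\<^sub>R u z) \<le> norm (indicator (ball 0 1) z *\<^sub>R u z)" for k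
      using sub[of k] by (intro AE_I2) (auto simp: indicator_def)
  qed simp
  then show ?thesis by (simp add: set_lebesgue_integral_def A_def)
qed

text \<open>If \<open>g 0 \<noteq> 0\<close>, the degenerate circle \<open>\<rho> = 0\<close>
  serves. Otherwise zeros are isolated, so a small circle around \<open>0\<close> carries none, and
  compactness provides a positive minimum \<open>m\<close>.\<close>

lemma nonvanishing_circle:
  assumes g: "g holomorphic_on ball 0 1" and "z0 \<in> ball 0 1" "g z0 \<noteq> 0"
  obtains \<rho> m where "0 \<le> \<rho>" "\<rho> \<le> 1 / 2" "0 < m" "\<And>z. cmod z = \<rho> \<Longrightarrow> m \<le> cmod (g z)"
proof (cases "g 0 = 0")
  case False
  then show ?thesis using that[of 0 "cmod (g 0)"] by simp
next
  case True
  obtain r where r: "0 < r" "ball 0 r \<subseteq> ball (0::complex) 1" "\<And>z. z \<in> ball 0 r - {0} \<Longrightarrow> g z \<noteq> 0"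
    by (rule isolated_zeros[OF g open_ball connected_ball _ True assms(2,3)]) auto
  define \<rho> where "\<rho> = min (r / 2) (1 / 2)"
  have \<rho>: "0 < \<rho>" "\<rho> < r" "\<rho> \<le> 1 / 2" using r by (auto simp: \<rho>_def)
  have "continuous_on (sphere 0 \<rho>) (\<lambda>z. cmod (g z))"
    using \<rho> by (intro continuous_on_norm holomorphic_on_imp_continuous_on holomorphic_on_subset[OF g]) auto
  moreover have "sphere (0::complex) \<rho> \<noteq> {}" using \<rho> by simp
  ultimately obtain w where w: "w \<in> sphere 0 \<rho>" "\<And>z. z \<in> sphere 0 \<rho> \<Longrightarrow> cmod (g w) \<le> cmod (g z)"
    using continuous_attains_inf[OF compact_sphere] by metis
  have "g w \<noteq> 0" using w(1) \<rho> by (intro r(3)) auto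
  then show ?thesis using that[of \<rho> "cmod (g w)"] w(2) \<rho> by auto
qed

text \<open>If \<open>h = F g\<close> is not identically zero, neither is \<open>g\<close>, so
  \<open>|g| \<ge> m > 0\<close> on some circle. The annulus estimate then bounds the integral of
  \<open>|h|^2\<close> below by a fixed \<open>c\<close> on infinitely many annuli, as
  \<open>m\<close> and \<open>C\<close> do not depend on \<open>k\<close>; but these integrals tend
  to \<open>0\<close>.\<close>

proposition bergman_uniqueness_disc_zeros:
  assumes F: "F holomorphic_on ball 0 1"
    and simple: "\<And>z. z \<in> ball 0 1 \<Longrightarrow> F z = 0 \<Longrightarrow> deriv F z \<noteq> 0"
    and C: "0 \<le> C" "\<exists>\<^sub>F k in sequentially. annulus_defect (rad k) (rad (Suc k)) F
        \<le> ennreal (C * measure lborel (annulus (rad k) (rad (Suc k))))"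
  shows "bergman_uniqueness_set (disc_zeros F)"
  unfolding bergman_uniqueness_set_def
proof (intro conjI ballI impI)
  show "disc_zeros F \<subseteq> ball 0 1" by (auto simp: disc_zeros_def)
  fix h and z0 :: complex assume h: "h \<in> bergman_space" and van: "\<forall>z\<in>disc_zeros F. h z = 0" and z0: "z0 \<in> ball 0 1"
  have hol: "h holomorphic_on ball 0 1" and int: "set_integrable lborel (ball 0 1) (\<lambda>z. (cmod (h z))\<^sup>2)"
    using h by (auto simp: bergman_space_def)
  obtain g where g: "g holomorphic_on ball 0 1" "\<And>z. z \<in> ball 0 1 \<Longrightarrow> h z = F z * g z"
    using holomorphic_quotient_simple_zeros[OF F hol open_ball simple] van by (auto simp: disc_zeros_def)
  show "h z0 = 0"
  proof (rule ccontr)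
    assume "h z0 \<noteq> 0"
    then have "g z0 \<noteq> 0" using g(2)[OF z0] by auto
    then obtain \<rho> m where \<rho>: "0 \<le> \<rho>" "\<rho> \<le> 1 / 2" and m: "0 < m" "\<And>z. cmod z = \<rho> \<Longrightarrow> m \<le> cmod (g z)"
      using nonvanishing_circle[OF g(1) z0] by blast
    define c where "c = pi / 4 * (m\<^sup>2 * exp (- (2 * ln 2 * C)))"
    have c: "0 < c" using m by (simp add: c_def)
    have "\<forall>\<^sub>F k in sequentially. (LINT z:annulus (rad k) (rad (Suc k))|lborel. (cmod (h z))\<^sup>2) < c"
      using annulus_integral_tendsto_0[OF int] c by (rule order_tendstoD)
    with C(2) have "\<exists>\<^sub>F k in sequentially. annulus_defect (rad k) (rad (Suc k)) F
        \<le> ennreal (C * measure lborel (annulus (rad k) (rad (Suc k))))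
        \<and> (LINT z:annulus (rad k) (rad (Suc k))|lborel. (cmod (h z))\<^sup>2) < c"
      by (rule frequently_eventually_conj[THEN frequently_elim1]) auto
    then obtain k where k: "annulus_defect (rad k) (rad (Suc k)) F
        \<le> ennreal (C * measure lborel (annulus (rad k) (rad (Suc k))))"
      "(LINT z:annulus (rad k) (rad (Suc k))|lborel. (cmod (h z))\<^sup>2) < c"
      by (auto dest: frequently_ex)
    have "c \<le> measure lborel (annulus (rad k) (rad (Suc k))) / (1 - (rad k)\<^sup>2) * (m\<^sup>2 * exp (- (2 * ln 2 * C)))"
      unfolding c_def by (intro mult_right_mono measure_annulus_rad_ge) auto
    also have "\<dots> = measure lborel (annulus (rad k) (rad (Suc k))) * (m\<^sup>2 * exp (- (2 * ln 2 * C)) / (1 - (rad k)\<^sup>2))"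
      by simp
    also have "\<dots> \<le> (LINT z:annulus (rad k) (rad (Suc k))|lborel. (cmod (F z * g z))\<^sup>2)"
      using \<rho> rad_bounds[of k] rad_bounds(3)[of "Suc k"]
      by (intro annulus_norm_integral_ge[OF F g(1) \<rho>(1) _ _ _ m C(1) k(1)]) auto
    also have "\<dots> = (LINT z:annulus (rad k) (rad (Suc k))|lborel. (cmod (h z))\<^sup>2)"
      using rad_bounds(3)[of "Suc k"]
      by (intro set_lebesgue_integral_cong) (auto simp: annulus_def g(2))
    finally show False using k(2) by simp
  qed
qed

subsection \<open>Small values of the Gaussian power series\<close>

lemma std_complex_gaussian_density_eq:
  "std_complex_gaussian_density (Complex x y) =
    normal_density 0 (1 / sqrt 2) x * normal_density 0 (1 / sqrt 2) y"
proof -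
  have "exp (- (x\<^sup>2 + y\<^sup>2)) / pi = exp (- x\<^sup>2) / sqrt pi * (exp (- y\<^sup>2) / sqrt pi)"
    by (simp add: exp_add[symmetric] minus_add_distrib mult.commute)
  then show ?thesis
    by (simp add: std_complex_gaussian_density_def normal_density_def cmod_power2 power_divide)
qed

lemma std_complex_gaussian_density_measurable [measurable]:
  "std_complex_gaussian_density \<in> borel_measurable borel"
  unfolding std_complex_gaussian_density_def[abs_def] by measurable

lemma nn_integral_normal_density:
  assumes "0 < \<sigma>"
  shows "(\<integral>\<^sup>+x. ennreal (normal_density \<mu> \<sigma> x) \<partial>lborel) = 1"
  using assms by (subst nn_integral_eq_integral) auto

lemma std_complex_gaussian_measurable:
  "std_complex_gaussian M X \<Longrightarrow> X \<in> borel_measurable M"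
  by (simp add: std_complex_gaussian_def distributed_def)

text \<open>Rotation invariance of density and measure removes \<open>u\<close>. The density is then
  a product over the two coordinates, and the imaginary one integrates to \<open>1\<close>.\<close>

lemma distributed_Re_std_complex_gaussian:
  assumes X: "std_complex_gaussian M X" and u: "cmod u = 1"
  shows "distributed M lborel (\<lambda>\<omega>. Re (u * X \<omega>)) (normal_density 0 (1 / sqrt 2))"
proof -
  note [measurable] = std_complex_gaussian_measurable[OF X]
  let ?n = "normal_density 0 (1 / sqrt 2)"
  have *: "(\<integral>\<^sup>+\<omega>. h (Re (u * X \<omega>)) \<partial>M) = (\<integral>\<^sup>+x. ennreal (?n x) * h x \<partial>lborel)"
    if [measurable]: "h \<in> borel_measurable borel" for h :: "real \<Rightarrow> ennreal"
  proof -
    have "(\<integral>\<^sup>+\<omega>. h (Re (u * X \<omega>)) \<partial>M)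
        = (\<integral>\<^sup>+z. ennreal (std_complex_gaussian_density z) * h (Re (u * z)) \<partial>lborel)"
      using X unfolding std_complex_gaussian_def
      by (rule distributed_nn_integral[symmetric]) simp
    also have "\<dots> = (\<integral>\<^sup>+z. ennreal (std_complex_gaussian_density (u * z)) * h (Re (u * z)) \<partial>lborel)"
      by (simp add: std_complex_gaussian_density_def norm_mult u)
    also have "\<dots> = (\<integral>\<^sup>+z. ennreal (std_complex_gaussian_density z) * h (Re z) \<partial>lborel)"
      by (rule nn_integral_lborel_rotate[OF _ u]) simp
    also have "\<dots> = (\<integral>\<^sup>+x. \<integral>\<^sup>+y. (ennreal (?n x) * h x) * ennreal (?n y) \<partial>lborel \<partial>lborel)"
      by (subst nn_integral_lborel_complex(1))
         (auto simp: std_complex_gaussian_density_eq ennreal_mult mult_ac)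
    also have "\<dots> = (\<integral>\<^sup>+x. ennreal (?n x) * h x \<partial>lborel)"
      by (subst nn_integral_cmult) (auto simp: nn_integral_normal_density)
    finally show ?thesis .
  qed
  show ?thesis
    unfolding distributed_def
  proof (intro conjI measure_eqI)
    fix A assume "A \<in> sets (distr M lborel (\<lambda>\<omega>. Re (u * X \<omega>)))"
    then have A [measurable]: "A \<in> sets borel" by simp
    have "emeasure (distr M lborel (\<lambda>\<omega>. Re (u * X \<omega>))) A
        = (\<integral>\<^sup>+x. indicator A x \<partial>distr M lborel (\<lambda>\<omega>. Re (u * X \<omega>)))"
      by simp
    also have "\<dots> = (\<integral>\<^sup>+\<omega>. indicator A (Re (u * X \<omega>)) \<partial>M)"
      by (rule nn_integral_distr) auto
    also have "\<dots> = emeasure (density lborel (normal_density 0 (1 / sqrt 2))) A"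
      by (subst *) (auto simp: emeasure_density)
    finally show "emeasure (distr M lborel (\<lambda>\<omega>. Re (u * X \<omega>))) A
        = emeasure (density lborel (normal_density 0 (1 / sqrt 2))) A" .
  qed auto
qed

text \<open>\<open>|X| \<le> |Re X| + |Im X|\<close> with \<open>Im X = Re (- \<i> * X)\<close>, and
  both parts have the same normal law. Fixing \<open>K\<close> before \<open>M\<close> and
  \<open>X\<close> gives one constant for all coefficients.\<close>

lemma nn_integral_norm_std_complex_gaussian_le:
  obtains K :: real where "0 \<le> K"
    "\<And>M (X :: 'a \<Rightarrow> complex). std_complex_gaussian M X \<Longrightarrow> (\<integral>\<^sup>+\<omega>. ennreal (cmod (X \<omega>)) \<partial>M) \<le> ennreal K"
proof -
  let ?n = "normal_density 0 (1 / sqrt 2)"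
  define K where "K = (\<integral>x. ?n x * \<bar>x\<bar> \<partial>lborel)"
  have "integrable lborel (\<lambda>x. ?n x * \<bar>x\<bar>)"
    using integrable_normal_moment_abs[of "1 / sqrt 2" 0 1] by simp
  then have nn: "(\<integral>\<^sup>+x. ennreal (?n x * \<bar>x\<bar>) \<partial>lborel) = ennreal K"
    unfolding K_def by (rule nn_integral_eq_integral) auto
  have K0: "0 \<le> K" unfolding K_def by (rule integral_nonneg_AE) auto
  have "(\<integral>\<^sup>+\<omega>. ennreal (cmod (X \<omega>)) \<partial>M) \<le> ennreal (2 * K)" if X: "std_complex_gaussian M X"
    for M :: "'a measure" and X :: "'a \<Rightarrow> complex"
  proof -
    note [measurable] = std_complex_gaussian_measurable[OF X]
    have part: "(\<integral>\<^sup>+\<omega>. ennreal \<bar>Re (u * X \<omega>)\<bar> \<partial>M) = ennreal K" if "cmod u = 1" for u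
      using distributed_nn_integral[OF distributed_Re_std_complex_gaussian[OF X that], of "\<lambda>x. ennreal \<bar>x\<bar>"] nn
      by (simp add: ennreal_mult')
    have "(\<integral>\<^sup>+\<omega>. ennreal (cmod (X \<omega>)) \<partial>M)
        \<le> (\<integral>\<^sup>+\<omega>. ennreal \<bar>Re (1 * X \<omega>)\<bar> + ennreal \<bar>Re (- \<i> * X \<omega>)\<bar> \<partial>M)"
      by (intro nn_integral_mono) (simp add: ennreal_plus[symmetric] cmod_le del: ennreal_plus)
    also have "\<dots> = (\<integral>\<^sup>+\<omega>. ennreal \<bar>Re (1 * X \<omega>)\<bar> \<partial>M) + (\<integral>\<^sup>+\<omega>. ennreal \<bar>Re (- \<i> * X \<omega>)\<bar> \<partial>M)"
      by (rule nn_integral_add) auto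
    also have "\<dots> = ennreal (2 * K)"
      using K0 by (subst (1 2) part) (auto simp: ennreal_plus[symmetric] simp del: ennreal_plus)
    finally show ?thesis .
  qed
  then show ?thesis using that[of "2 * K"] K0 by simp
qed

section \<open>The radius of convergence is almost surely at least 1\<close>

text \<open>Turns the radius into countably many conditions on nonnegative series, which are
  measurable and can be checked through expectations. They suffice because \<open>rad k\<close>
  tends to \<open>1\<close>.\<close>

lemma conv_radius_ge_1_iff:
  fixes a :: "nat \<Rightarrow> complex"
  shows "1 \<le> conv_radius a \<longleftrightarrow> (\<forall>k. (\<Sum>n. ennreal (cmod (a n) * rad k ^ n)) \<noteq> \<infinity>)"
proof
  assume *: "1 \<le> conv_radius a"
  show "\<forall>k. (\<Sum>n. ennreal (cmod (a n) * rad k ^ n)) \<noteq> \<infinity>"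
  proof
    fix k
    have r: "0 \<le> rad k" "rad k < 1" using rad_bounds[of k] by auto
    have "ereal (norm (of_real (rad k) :: complex)) < conv_radius a"
      by (rule less_le_trans[OF _ *]) (use r in simp)
    from abs_summable_in_conv_radius[OF this]
    have "summable (\<lambda>n. cmod (a n) * rad k ^ n)"
      using r by (simp add: norm_mult norm_power)
    then show "(\<Sum>n. ennreal (cmod (a n) * rad k ^ n)) \<noteq> \<infinity>"
      using r by (subst suminf_ennreal2) auto
  qed
next
  assume *: "\<forall>k. (\<Sum>n. ennreal (cmod (a n) * rad k ^ n)) \<noteq> \<infinity>"
  show "1 \<le> conv_radius a"
  proof (rule conv_radius_geI_ex)
    fix r :: real assume r: "0 < r" "ereal r < 1"
    then have "eventually (\<lambda>k. r < rad k) sequentially"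
      using rad_tendsto by (intro order_tendstoD(1)) auto
    then obtain k where k: "r < rad k" by (auto dest: eventually_happens)
    have "summable (\<lambda>n. cmod (a n) * rad k ^ n)"
      using * rad_bounds(1)[of k] by (intro summable_suminf_not_top) auto
    then have "summable (\<lambda>n. norm (a n * of_real (rad k) ^ n))"
      using rad_bounds(1)[of k] by (simp add: norm_mult norm_power)
    then have "summable (\<lambda>n. a n * of_real (rad k) ^ n)"
      by (rule summable_norm_cancel)
    then have "summable (\<lambda>n. a n * of_real r ^ n)"
      by (rule powser_inside) (use r k in auto)
    then show "\<exists>z. norm z = r \<and> summable (\<lambda>n. a n * z ^ n)"
      using r by (intro exI[of _ "of_real r"]) auto
  qed
qed

text \<open>The first absolute moments of the coefficients share a bound \<open>K\<close>, so the
  expected absolute series at \<open>rad k\<close> is dominated by a geometric series and is almost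
  surely finite.\<close>

lemma AE_conv_radius_ge_1:
  assumes f: "\<And>n. std_complex_gaussian M (f n)"
  shows "AE \<omega> in M. 1 \<le> conv_radius (\<lambda>n. f n \<omega>)"
proof -
  note [measurable] = std_complex_gaussian_measurable[OF f]
  obtain K where K: "0 \<le> K" "\<And>n. (\<integral>\<^sup>+\<omega>. ennreal (cmod (f n \<omega>)) \<partial>M) \<le> ennreal K"
    using nn_integral_norm_std_complex_gaussian_le[where ?'a='a] f by metis
  have "AE \<omega> in M. (\<Sum>n. ennreal (cmod (f n \<omega>) * rad k ^ n)) \<noteq> \<infinity>" for k
  proof (rule nn_integral_noteq_infinite)
    have r: "0 \<le> rad k" "rad k < 1" using rad_bounds[of k] by auto
    have "(\<integral>\<^sup>+\<omega>. (\<Sum>n. ennreal (cmod (f n \<omega>) * rad k ^ n)) \<partial>M)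
        = (\<Sum>n. \<integral>\<^sup>+\<omega>. ennreal (rad k ^ n) * ennreal (cmod (f n \<omega>)) \<partial>M)"
      using r by (subst nn_integral_suminf) (auto simp: ennreal_mult' mult.commute)
    also have "\<dots> \<le> (\<Sum>n. ennreal (rad k ^ n * K))"
      using r K by (intro suminf_le) (auto simp: nn_integral_cmult ennreal_mult intro!: mult_left_mono)
    also have "\<dots> = ennreal (\<Sum>n. rad k ^ n * K)"
      using r K by (intro suminf_ennreal2 summable_mult2 summable_geometric) auto
    finally show "(\<integral>\<^sup>+\<omega>. (\<Sum>n. ennreal (cmod (f n \<omega>) * rad k ^ n)) \<partial>M) \<noteq> \<infinity>"
      by (auto simp: top_unique)
  qed measurable
  then show ?thesis
    by (simp add: conv_radius_ge_1_iff AE_all_countable)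
qed

section \<open>Small ball probabilities and the expected defect\<close>

text \<open>An interval of length \<open>2 * t\<close> has mass at most its length times the peak of
  the density.\<close>

lemma normal_small_ball:
  assumes X: "distributed M lborel X (normal_density 0 \<sigma>)" and \<sigma>: "0 < \<sigma>" and t: "0 \<le> t"
  shows "emeasure M {\<omega>\<in>space M. \<bar>X \<omega>\<bar> < t} \<le> ennreal (2 * t / sqrt (2 * pi * \<sigma>\<^sup>2))"
proof -
  have "{\<omega>\<in>space M. \<bar>X \<omega>\<bar> < t} = X -` {-t<..<t} \<inter> space M" by auto
  then have "emeasure M {\<omega>\<in>space M. \<bar>X \<omega>\<bar> < t}
      = (\<integral>\<^sup>+x. ennreal (normal_density 0 \<sigma> x) * indicator {-t<..<t} x \<partial>lborel)"
    using X by (simp add: distributed_emeasure)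
  also have "\<dots> \<le> (\<integral>\<^sup>+x. ennreal (1 / sqrt (2 * pi * \<sigma>\<^sup>2)) * indicator {-t<..<t} x \<partial>lborel)"
  proof (intro nn_integral_mono mult_right_mono ennreal_leI)
    show "normal_density 0 \<sigma> x \<le> 1 / sqrt (2 * pi * \<sigma>\<^sup>2)" for x
      unfolding normal_density_def by (rule mult_left_le) auto
  qed simp
  also have "\<dots> = ennreal (2 * t / sqrt (2 * pi * \<sigma>\<^sup>2))"
    using t by (simp add: nn_integral_cmult_indicator ennreal_mult'[symmetric])
  finally show ?thesis .
qed

context prob_space
begin

text \<open>With \<open>q = |z|^2\<close>, independence makes the normalised real part a centred
  normal variable of variance \<open>(1 - q ^ n) / 2\<close>. The hypothesis on \<open>n\<close>
  keeps this at least \<open>1 / 4\<close>, so the density stays below \<open>1\<close>.\<close>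

lemma partial_sum_small_ball:
  fixes f :: "nat \<Rightarrow> 'a \<Rightarrow> complex"
  assumes indep: "indep_vars (\<lambda>_. borel) f UNIV" and f: "\<And>n. std_complex_gaussian M (f n)"
    and z: "z \<noteq> 0" "cmod z < 1" and n: "(cmod z)\<^sup>2 ^ n \<le> 1 / 2" and t: "0 \<le> t"
  shows "emeasure M {\<omega>\<in>space M. \<bar>sqrt (1 - (cmod z)\<^sup>2) * Re (\<Sum>k<n. f k \<omega> * z ^ k)\<bar> < t} \<le> ennreal (2 * t)"
proof -
  define q where "q = (cmod z)\<^sup>2"
  have q: "0 < q" "q < 1" using z by (auto simp: q_def abs_square_less_1)
  have n0: "0 < n" using n by (cases n) auto
  define \<sigma> where "\<sigma> = (\<lambda>k. cmod z ^ k / sqrt 2)"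
  have normal: "distributed M lborel (\<lambda>\<omega>. Re (f k \<omega> * z ^ k)) (normal_density 0 (\<sigma> k))" for k
  proof -
    \<comment> \<open>The argument of \<open>z ^ k\<close> is absorbed by the rotation invariance of
      \<open>f k\<close>; only the scaling by \<open>cmod z ^ k\<close> remains.\<close>
    define u where "u = (z / of_real (cmod z)) ^ k"
    have u: "cmod u = 1" using z by (simp add: u_def norm_power norm_divide)
    have zk: "z ^ k = of_real (cmod z ^ k) * u"
      using z by (simp add: u_def power_divide)
    have "distributed M lborel (\<lambda>\<omega>. 0 + cmod z ^ k * Re (u * f k \<omega>))
        (normal_density (0 + cmod z ^ k * 0) (\<bar>cmod z ^ k\<bar> * (1 / sqrt 2)))"
      using z by (intro normal_density_affine distributed_Re_std_complex_gaussian f u) auto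
    moreover have "Re (f k \<omega> * z ^ k) = 0 + cmod z ^ k * Re (u * f k \<omega>)" for \<omega>
      unfolding zk by (simp add: algebra_simps)
    ultimately show ?thesis by (simp add: \<sigma>_def)
  qed
  have "indep_vars (\<lambda>_. borel) (\<lambda>k \<omega>. Re (f k \<omega> * z ^ k)) UNIV"
    by (rule indep_vars_compose2[OF indep]) simp
  then have indep': "indep_vars (\<lambda>_. borel) (\<lambda>k \<omega>. Re (f k \<omega> * z ^ k)) {..<n}"
    by (rule indep_vars_subset) simp
  define s where "s = sqrt (\<Sum>k<n. (\<sigma> k)\<^sup>2)"
  have "distributed M lborel (\<lambda>\<omega>. \<Sum>k<n. Re (f k \<omega> * z ^ k)) (normal_density (\<Sum>k<n. 0) s)"
    unfolding s_def using n0 z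
    by (intro sum_indep_normal indep' normal) (auto simp: \<sigma>_def)
  then have dist: "distributed M lborel (\<lambda>\<omega>. Re (\<Sum>k<n. f k \<omega> * z ^ k)) (normal_density 0 s)"
    by simp
  have "(\<Sum>k<n. (\<sigma> k)\<^sup>2) = (\<Sum>k<n. q ^ k) / 2"
    by (simp add: \<sigma>_def q_def power_divide sum_divide_distrib power_mult[symmetric] mult.commute)
  also have "\<dots> = (1 - q ^ n) / (1 - q) / 2"
    using q by (simp add: sum_gp_strict)
  finally have sum: "(\<Sum>k<n. (\<sigma> k)\<^sup>2) = (1 - q ^ n) / (1 - q) / 2" .
  have qn: "1 / 2 \<le> 1 - q ^ n" using n by (simp add: q_def)
  have s2: "s\<^sup>2 = (1 - q ^ n) / (1 - q) / 2"
    unfolding s_def sum using q qn by simp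
  have s0: "0 < s" unfolding s_def sum using q qn by simp
  define c where "c = sqrt (1 - q)"
  have c: "0 < c" "c\<^sup>2 = 1 - q" using q by (auto simp: c_def)
  have "{\<omega>\<in>space M. \<bar>c * Re (\<Sum>k<n. f k \<omega> * z ^ k)\<bar> < t} = {\<omega>\<in>space M. \<bar>Re (\<Sum>k<n. f k \<omega> * z ^ k)\<bar> < t / c}"
    using c by (auto simp: abs_mult pos_less_divide_eq mult.commute)
  also have "emeasure M \<dots> \<le> ennreal (2 * (t / c) / sqrt (2 * pi * s\<^sup>2))"
    using c t by (intro normal_small_ball[OF dist s0]) auto
  also have "\<dots> \<le> ennreal (2 * t)"
  proof (rule ennreal_leI)
    have "c\<^sup>2 * (2 * pi * s\<^sup>2) = pi * ((1 - q) * ((1 - q ^ n) / (1 - q)))"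
      unfolding c(2) s2 by (simp only: times_divide_eq_right) simp
    also have "\<dots> = pi * (1 - q ^ n)" using q by simp
    also have "\<dots> \<ge> 2 * (1 / 2)"
      using qn pi_ge_two by (intro mult_mono) auto
    finally have "1 \<le> sqrt (c\<^sup>2 * (2 * pi * s\<^sup>2))" by simp
    also have "\<dots> = c * sqrt (2 * pi * s\<^sup>2)"
      by (subst real_sqrt_mult) (use c(1) in simp)
    finally have *: "1 \<le> c * sqrt (2 * pi * s\<^sup>2)" .
    have "2 * (t / c) / sqrt (2 * pi * s\<^sup>2) = 2 * t / (c * sqrt (2 * pi * s\<^sup>2))" by simp
    also have "\<dots> \<le> 2 * t / 1"
      using * t by (intro divide_left_mono) auto
    finally show "2 * (t / c) / sqrt (2 * pi * s\<^sup>2) \<le> 2 * t" by simp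
  qed
  finally show ?thesis by (simp add: c_def q_def)
qed

text \<open>The condition \<open>|y| < t\<close> is open, so if it holds for the limit it eventually
  holds for the partial sums. Fatou's lemma then passes their bound, valid for all large
  \<open>n\<close>, to the limit.\<close>

lemma power_series_small_ball:
  fixes f :: "nat \<Rightarrow> 'a \<Rightarrow> complex"
  assumes indep: "indep_vars (\<lambda>_. borel) f UNIV" and f: "\<And>n. std_complex_gaussian M (f n)"
    and z: "z \<noteq> 0" "cmod z < 1" and t: "0 \<le> t"
  shows "(\<integral>\<^sup>+\<omega>. indicator {y. \<bar>y\<bar> < t} (sqrt (1 - (cmod z)\<^sup>2) * Re (power_series (\<lambda>n. f n \<omega>) z)) \<partial>M)
    \<le> ennreal (2 * t)"
proof -
  note [measurable] = std_complex_gaussian_measurable[OF f]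
  let ?S = "\<lambda>n \<omega>. sqrt (1 - (cmod z)\<^sup>2) * Re (\<Sum>k<n. f k \<omega> * z ^ k)"
  let ?L = "\<lambda>\<omega>. sqrt (1 - (cmod z)\<^sup>2) * Re (power_series (\<lambda>n. f n \<omega>) z)"
  have "AE \<omega> in M. indicator {y. \<bar>y\<bar> < t} (?L \<omega>) \<le> (liminf (\<lambda>n. indicator {y. \<bar>y\<bar> < t} (?S n \<omega>)) :: ennreal)"
    using AE_conv_radius_ge_1[of M f, OF f]
  proof eventually_elim
    case (elim \<omega>)
    have "summable (\<lambda>n. f n \<omega> * z ^ n)"
      using elim z(2) by (intro summable_in_conv_radius) (metis ereal_less(3) less_le_trans)
    then have "(\<lambda>n. \<Sum>k<n. f k \<omega> * z ^ k) \<longlonglongrightarrow> power_series (\<lambda>n. f n \<omega>) z"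
      unfolding power_series_def by (rule summable_LIMSEQ)
    then have lim: "(\<lambda>n. \<bar>?S n \<omega>\<bar>) \<longlonglongrightarrow> \<bar>?L \<omega>\<bar>"
      by (intro tendsto_intros)
    show ?case
    proof (cases "\<bar>?L \<omega>\<bar> < t")
      case True
      have "eventually (\<lambda>n. \<bar>?S n \<omega>\<bar> < t) sequentially"
        using order_tendstoD(2)[OF lim True] .
      then have "eventually (\<lambda>n. (1::ennreal) \<le> indicator {y. \<bar>y\<bar> < t} (?S n \<omega>)) sequentially"
        by eventually_elim (simp add: indicator_def)
      then show ?thesis
        using True by (auto intro: Liminf_bounded)
    qed simp
  qed
  then have "(\<integral>\<^sup>+\<omega>. indicator {y. \<bar>y\<bar> < t} (?L \<omega>) \<partial>M)
      \<le> (\<integral>\<^sup>+\<omega>. liminf (\<lambda>n. indicator {y. \<bar>y\<bar> < t} (?S n \<omega>)) \<partial>M)"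
    by (rule nn_integral_mono_AE)
  also have "\<dots> \<le> liminf (\<lambda>n. \<integral>\<^sup>+\<omega>. indicator {y. \<bar>y\<bar> < t} (?S n \<omega>) \<partial>M)"
    by (rule nn_integral_liminf) measurable
  also have "\<dots> \<le> ennreal (2 * t)"
  proof (rule Liminf_le)
    have "(\<lambda>n. (cmod z)\<^sup>2 ^ n) \<longlonglongrightarrow> 0"
      using z by (intro LIMSEQ_power_zero) (simp add: abs_square_less_1)
    then have "eventually (\<lambda>n. (cmod z)\<^sup>2 ^ n < 1 / 2) sequentially"
      by (rule order_tendstoD) simp
    then show "\<forall>\<^sub>F n in sequentially. (\<integral>\<^sup>+\<omega>. indicator {y. \<bar>y\<bar> < t} (?S n \<omega>) \<partial>M) \<le> ennreal (2 * t)"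
    proof eventually_elim
      case (elim n)
      have "(\<integral>\<^sup>+\<omega>. indicator {y. \<bar>y\<bar> < t} (?S n \<omega>) \<partial>M)
          = (\<integral>\<^sup>+\<omega>. indicator {\<omega>\<in>space M. \<bar>?S n \<omega>\<bar> < t} \<omega> \<partial>M)"
        by (rule nn_integral_cong) (simp add: indicator_def)
      also have "\<dots> = emeasure M {\<omega>\<in>space M. \<bar>?S n \<omega>\<bar> < t}"
        by (rule nn_integral_indicator) measurable
      also have "\<dots> \<le> ennreal (2 * t)"
        using elim by (intro partial_sum_small_ball[OF indep f z _ t]) auto
      finally show ?case .
    qed
  qed simp
  finally show ?thesis .
qed

text \<open>Integrating term by term, the small ball bounds \<open>2 * (1 / 2 ^ n)\<close> sum to
  \<open>4\<close>, uniformly in \<open>z\<close>.\<close>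

lemma nn_integral_log_defect_power_series_le:
  fixes f :: "nat \<Rightarrow> 'a \<Rightarrow> complex"
  assumes indep: "indep_vars (\<lambda>_. borel) f UNIV" and f: "\<And>n. std_complex_gaussian M (f n)"
    and z: "z \<noteq> 0" "cmod z < 1"
  shows "(\<integral>\<^sup>+\<omega>. log_defect (sqrt (1 - (cmod z)\<^sup>2) * Re (power_series (\<lambda>n. f n \<omega>) z)) \<partial>M) \<le> 4"
proof -
  note [measurable] = std_complex_gaussian_measurable[OF f]
  have "(\<integral>\<^sup>+\<omega>. log_defect (sqrt (1 - (cmod z)\<^sup>2) * Re (power_series (\<lambda>n. f n \<omega>) z)) \<partial>M)
      = (\<Sum>n. \<integral>\<^sup>+\<omega>. indicator {y. \<bar>y\<bar> < 1 / 2 ^ n} (sqrt (1 - (cmod z)\<^sup>2) * Re (power_series (\<lambda>n. f n \<omega>) z)) \<partial>M)"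
    unfolding log_defect_def power_series_def by (rule nn_integral_suminf) measurable
  also have "\<dots> \<le> (\<Sum>n. ennreal (2 * (1 / 2 ^ n)))"
    by (intro suminf_le power_series_small_ball[OF indep f z]) auto
  also have "\<dots> = ennreal 4"
  proof (rule suminf_ennreal_eq)
    have "(\<lambda>n. 2 * (1 / 2) ^ n) sums (2 * (1 / (1 - 1 / 2 :: real)))"
      by (intro sums_mult geometric_sums) simp
    then show "(\<lambda>n. 2 * (1 / 2 ^ n)) sums (4 :: real)" by (simp add: power_divide)
  qed simp
  finally show ?thesis by simp
qed

text \<open>By Tonelli the mean defect \<open>X k\<close> over the \<open>k\<close>-th annulus has
  expectation at most \<open>4\<close>. Fatou's lemma makes the lower limit of \<open>X k\<close>
  almost surely finite, which gives a bound along infinitely many \<open>k\<close>; the constant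
  \<open>C\<close> depends on the sample point.\<close>

proposition AE_frequently_annulus_defect_le:
  fixes f :: "nat \<Rightarrow> 'a \<Rightarrow> complex"
  assumes indep: "indep_vars (\<lambda>_. borel) f UNIV" and f: "\<And>n. std_complex_gaussian M (f n)"
  shows "AE \<omega> in M. \<exists>C\<ge>0. \<exists>\<^sub>F k in sequentially.
    annulus_defect (rad k) (rad (Suc k)) (power_series (\<lambda>n. f n \<omega>))
      \<le> ennreal (C * measure lborel (annulus (rad k) (rad (Suc k))))"
proof -
  note [measurable] = std_complex_gaussian_measurable[OF f]
  interpret P: pair_sigma_finite M "lborel :: complex measure"
    by (intro pair_sigma_finite.intro sigma_finite_lborel sigma_finite_measure_axioms)
  define A where "A = (\<lambda>k. annulus (rad k) (rad (Suc k)))"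
  define a where "a = (\<lambda>k. measure lborel (A k))"
  define d where "d = (\<lambda>k \<omega>. annulus_defect (rad k) (rad (Suc k)) (power_series (\<lambda>n. f n \<omega>)))"
  have A_eq: "annulus (rad k) (rad (Suc k)) = A k" for k by (simp add: A_def)
  have [measurable]: "A k \<in> sets borel" for k by (simp add: A_def)
  have a0: "0 < a k" for k
    unfolding a_def A_def using rad_bounds[of k]
    by (simp add: measure_annulus power_strict_mono)
  have em: "emeasure lborel (A k) = ennreal (a k)" for k
    using emeasure_annulus_finite[of "rad k" "rad (Suc k)"]
    by (simp add: a_def A_def emeasure_eq_ennreal_measure)
  have joint: "(\<lambda>(\<omega>, z). log_defect (sqrt (1 - (cmod z)\<^sup>2) * Re (power_series (\<lambda>n. f n \<omega>) z)) * indicator (A k) z)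
      \<in> borel_measurable (M \<Otimes>\<^sub>M lborel)" for k
    unfolding power_series_def by measurable
  have d_meas [measurable]: "d k \<in> borel_measurable M" for k
    using lborel.borel_measurable_nn_integral[OF joint[of k]] by (simp add: d_def annulus_defect_def A_def)
  have dE: "(\<integral>\<^sup>+\<omega>. d k \<omega> \<partial>M) \<le> ennreal (4 * a k)" for k
  proof -
    have "(\<integral>\<^sup>+\<omega>. d k \<omega> \<partial>M)
        = (\<integral>\<^sup>+z. \<integral>\<^sup>+\<omega>. log_defect (sqrt (1 - (cmod z)\<^sup>2) * Re (power_series (\<lambda>n. f n \<omega>) z)) * indicator (A k) z \<partial>M \<partial>lborel)"
      unfolding d_def annulus_defect_def A_eq by (rule P.Fubini'[OF joint, symmetric])
    also have "\<dots> \<le> (\<integral>\<^sup>+z. 4 * indicator (A k) z \<partial>lborel)"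
    proof (rule nn_integral_mono)
      fix z
      show "(\<integral>\<^sup>+\<omega>. log_defect (sqrt (1 - (cmod z)\<^sup>2) * Re (power_series (\<lambda>n. f n \<omega>) z)) * indicator (A k) z \<partial>M)
          \<le> 4 * indicator (A k) z"
      proof (cases "z \<in> A k")
        case True
        then have "z \<noteq> 0" "cmod z < 1"
          using rad_bounds[of k] rad_bounds(3)[of "Suc k"] by (auto simp: A_def annulus_def)
        with True show ?thesis
          using nn_integral_log_defect_power_series_le[OF indep f] by simp
      qed simp
    qed
    also have "\<dots> = ennreal (4 * a k)"
      using a0[of k] by (simp add: nn_integral_cmult_indicator em ennreal_mult)
    finally show ?thesis .
  qed
  define X where "X = (\<lambda>k \<omega>. ennreal (1 / a k) * d k \<omega>)"
  have [measurable]: "X k \<in> borel_measurable M" for k unfolding X_def by measurable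
  have "(\<integral>\<^sup>+\<omega>. X k \<omega> \<partial>M) \<le> 4" for k
  proof -
    have "(\<integral>\<^sup>+\<omega>. X k \<omega> \<partial>M) = ennreal (1 / a k) * (\<integral>\<^sup>+\<omega>. d k \<omega> \<partial>M)"
      unfolding X_def by (rule nn_integral_cmult) measurable
    also have "\<dots> \<le> ennreal (1 / a k) * ennreal (4 * a k)"
      by (intro mult_left_mono dE) simp
    also have "\<dots> = ennreal 4"
      using a0[of k] by (subst ennreal_mult'[symmetric]) auto
    finally show ?thesis by simp
  qed
  then have "liminf (\<lambda>k. \<integral>\<^sup>+\<omega>. X k \<omega> \<partial>M) \<le> 4"
    by (intro Liminf_le) auto
  then have "(\<integral>\<^sup>+\<omega>. liminf (\<lambda>k. X k \<omega>) \<partial>M) \<le> 4"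
    by (intro order.trans[OF nn_integral_liminf]) auto
  then have "(\<integral>\<^sup>+\<omega>. liminf (\<lambda>k. X k \<omega>) \<partial>M) \<noteq> \<infinity>"
    by (auto simp: top_unique)
  then have "AE \<omega> in M. liminf (\<lambda>k. X k \<omega>) \<noteq> \<infinity>"
    by (intro nn_integral_noteq_infinite) auto
  then show ?thesis
  proof eventually_elim
    case (elim \<omega>)
    then obtain c where c: "liminf (\<lambda>k. X k \<omega>) = ennreal c" "0 \<le> c"
      by (cases "liminf (\<lambda>k. X k \<omega>)") auto
    \<comment> \<open>Any value strictly above the lower limit is undercut infinitely often.\<close>
    define C where "C = c + 1"
    have "liminf (\<lambda>k. X k \<omega>) < ennreal C"
      using c by (simp add: C_def ennreal_less_iff)
    then have "\<exists>\<^sub>F k in sequentially. X k \<omega> < ennreal C"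
      using Liminf_bounded[of "ennreal C" "\<lambda>k. X k \<omega>" sequentially]
      by (auto simp: frequently_def not_less not_le[symmetric])
    then have "\<exists>\<^sub>F k in sequentially. d k \<omega> \<le> ennreal (C * a k)"
    proof (rule frequently_elim1)
      fix k assume X: "X k \<omega> < ennreal C"
      have "d k \<omega> = ennreal (a k) * X k \<omega>"
        using a0[of k] by (simp add: X_def mult.assoc[symmetric] ennreal_mult'[symmetric])
      also have "\<dots> \<le> ennreal (a k) * ennreal C"
        using X by (intro mult_left_mono) auto
      also have "\<dots> = ennreal (C * a k)"
        using a0[of k] by (simp add: ennreal_mult''[symmetric] mult.commute)
      finally show "d k \<omega> \<le> ennreal (C * a k)" .
    qed
    moreover have "0 \<le> C" using c by (simp add: C_def)
    ultimately show ?case unfolding d_def a_def A_def by blast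
  qed
qed

end

subsection \<open>Simplicity of the zeros\<close>

lemma power_series_has_field_derivative:
  assumes "ereal (cmod z) < conv_radius a"
  shows "(power_series a has_field_derivative power_series (diffs a) z) (at z)"
  using has_field_derivative_powser[OF assms, of UNIV] by (simp add: power_series_def[abs_def])

lemma holomorphic_power_series:
  assumes "1 \<le> conv_radius a"
  shows "power_series a holomorphic_on ball 0 1"
    and "power_series (diffs a) holomorphic_on ball 0 1"
    and "z \<in> ball 0 1 \<Longrightarrow> deriv (power_series a) z = power_series (diffs a) z"
proof -
  have der: "(power_series a has_field_derivative power_series (diffs a) z) (at z)" if "z \<in> ball 0 1" for z
  proof (rule power_series_has_field_derivative)
    have "ereal (cmod z) < 1" using that by simp
    then show "ereal (cmod z) < conv_radius a" using assms by (rule less_le_trans)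
  qed
  show hol: "power_series a holomorphic_on ball 0 1"
    unfolding holomorphic_on_def field_differentiable_def
    using der has_field_derivative_at_within by blast
  show deriv: "deriv (power_series a) z = power_series (diffs a) z" if "z \<in> ball 0 1" for z
    using der[OF that] by (rule DERIV_imp_deriv)
  have "deriv (power_series a) holomorphic_on ball 0 1"
    by (rule holomorphic_deriv[OF hol open_ball])
  then show "power_series (diffs a) holomorphic_on ball 0 1"
    by (rule holomorphic_transform) (rule deriv)
qed

text \<open>The law has a density, and countable sets are Lebesgue null.\<close>

lemma AE_std_complex_gaussian_notin:
  assumes X: "std_complex_gaussian M X" and S: "countable S"
  shows "AE \<omega> in M. X \<omega> \<notin> S"
proof -
  have X_meas: "X \<in> measurable M lborel" and [measurable]: "S \<in> sets borel"
    using std_complex_gaussian_measurable[OF X] countable_imp_null_set_lborel[OF S] by auto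
  have "AE z in density lborel std_complex_gaussian_density. z \<notin> S"
    by (subst AE_density) (use AE_not_in[OF countable_imp_null_set_lborel[OF S]] in auto)
  also have "density lborel std_complex_gaussian_density = distr M lborel X"
    using X by (simp add: std_complex_gaussian_def distributed_def)
  finally show ?thesis by (subst (asm) AE_distr_iff[OF X_meas]) auto
qed

context prob_space
begin

text \<open>A double zero of \<open>c + G\<close>, where \<open>G\<close> collects the terms of positive degree, makes \<open>- c\<close> a
  critical value of \<open>G\<close>. These values are countable in number, and \<open>c\<close> is independent of \<open>G\<close>.
  The approximate condition over a countable dense set makes the exceptional event measurable.\<close>

lemma AE_power_series_simple_zeros:
  fixes f :: "nat \<Rightarrow> 'a \<Rightarrow> complex"
  assumes indep: "indep_vars (\<lambda>_. borel) f UNIV" and f: "\<And>n. std_complex_gaussian M (f n)"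
  shows "AE \<omega> in M. \<forall>z\<in>ball 0 1. power_series (\<lambda>n. f n \<omega>) z = 0 \<longrightarrow>
    deriv (power_series (\<lambda>n. f n \<omega>)) z \<noteq> 0"
proof -
  note [measurable] = std_complex_gaussian_measurable[OF f]
  \<comment> \<open>The sequence is split into two independent blocks: \<open>Y\<close> holds the
    coefficients of positive index, \<open>X\<close> the constant term. Updating \<open>Y\<close> at
    \<open>0\<close> restores the whole sequence.\<close>
  define N where "N = PiM {1..} (\<lambda>_::nat. borel :: complex measure)"
  define Y where "Y = (\<lambda>\<omega>. \<lambda>n\<in>{1..}. f n \<omega>)"
  define N0 where "N0 = PiM {0} (\<lambda>_::nat. borel :: complex measure)"
  define X where "X = (\<lambda>\<omega>. \<lambda>n\<in>{0}. f n \<omega>)"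
  have iv: "indep_var N Y N0 X"
    unfolding N_def Y_def N0_def X_def by (rule indep_var_restrict[OF indep]) auto
  have Y [measurable]: "Y \<in> measurable M N" and X [measurable]: "X \<in> measurable M N0"
    using iv by (rule indep_var_rv1, rule indep_var_rv2)
  have joint: "distr M N Y \<Otimes>\<^sub>M distr M N0 X = distr M (N \<Otimes>\<^sub>M N0) (\<lambda>\<omega>. (Y \<omega>, X \<omega>))"
    using iv by (simp add: indep_var_distribution_eq)
  have X0: "X \<omega> 0 = f 0 \<omega>" for \<omega> by (simp add: X_def)
  have Y_upd: "(Y \<omega>)(0 := f 0 \<omega>) = (\<lambda>n. f n \<omega>)" for \<omega>
    by (auto simp: Y_def fun_eq_iff)
  have coeff [measurable]: "(\<lambda>y. y (Suc n)) \<in> borel_measurable N" for n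
    unfolding N_def by (rule measurable_component_singleton) simp
  have coeff0 [measurable]: "(\<lambda>x. x 0) \<in> borel_measurable N0"
    unfolding N0_def by (rule measurable_component_singleton) simp
  have coeff' [measurable]: "(\<lambda>p. ((fst p)(0 := snd p 0)) n) \<in> borel_measurable (N \<Otimes>\<^sub>M N0)" for n
    by (cases n) simp_all
  have diffs_upd: "diffs (y(0 := c)) = diffs y" for y :: "nat \<Rightarrow> complex" and c
    by (simp add: diffs_def fun_eq_iff)
  \<comment> \<open>A measurable condition on the positive-index coefficients alone: the radius is
    at least \<open>1\<close>, and the derivative is nonzero at the origin, hence not identically
    zero.\<close>
  define good where "good = (\<lambda>y :: nat \<Rightarrow> complex.
    (\<forall>k. (\<Sum>n. ennreal (cmod (y (Suc n)) * rad k ^ n)) \<noteq> \<infinity>) \<and> y (Suc 0) \<noteq> 0)"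
  have good_radius: "1 \<le> conv_radius (y(0 := c))" if "good y" for y c
  proof -
    have "1 \<le> conv_radius (\<lambda>n. y (Suc n))"
      using that unfolding good_def conv_radius_ge_1_iff by blast
    also have "(\<lambda>n. y (Suc n)) = (\<lambda>n. (y(0 := c)) (n + 1))" by simp
    finally show ?thesis by (simp only: conv_radius_shift)
  qed
  have AE_good: "AE y in distr M N Y. good y"
  proof (subst AE_distr_iff[OF Y])
    show "{y \<in> space N. good y} \<in> sets N" unfolding good_def by measurable
    have "AE \<omega> in M. f (Suc 0) \<omega> \<notin> {0}"
      by (rule AE_std_complex_gaussian_notin[OF f]) simp
    with AE_conv_radius_ge_1[of M f, OF f] show "AE \<omega> in M. good (Y \<omega>)"
    proof eventually_elim
      case (elim \<omega>)
      have "1 \<le> conv_radius (\<lambda>n. f (n + 1) \<omega>)"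
        using elim(1) conv_radius_shift[of "\<lambda>n. f n \<omega>" 1] by simp
      with elim(2) show ?case by (simp add: good_def Y_def conv_radius_ge_1_iff)
    qed
  qed
  have "AE \<omega> in M. \<forall>z\<in>cball 0 (rad k). power_series (\<lambda>n. f n \<omega>) z = 0 \<longrightarrow>
      deriv (power_series (\<lambda>n. f n \<omega>)) z \<noteq> 0" for k
  proof -
    define K where "K = cball (0::complex) (rad k)"
    have K: "compact K" "K \<noteq> {}" "K \<subseteq> ball 0 1"
      using rad_bounds[of k] by (auto simp: K_def)
    obtain T where T: "countable T" "T \<subseteq> K" "K \<subseteq> closure T" by (rule separable)
    have "T \<noteq> {}" using T(3) K(2) by auto
    define q where "q = from_nat_into T"
    have q: "range q = T" unfolding q_def by (rule range_from_nat_into[OF \<open>T \<noteq> {}\<close> T(1)])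
    \<comment> \<open>\<open>\<phi> a\<close> vanishes exactly at the common zeros of the series and
      its termwise derivative.\<close>
    define \<phi> where "\<phi> = (\<lambda>a z. cmod (power_series a z) + cmod (power_series (diffs a) z))"
    have cont: "continuous_on K (\<phi> a)" if "1 \<le> conv_radius a" for a
      unfolding \<phi>_def using holomorphic_power_series[OF that] K(3)
      by (intro continuous_intros) (meson holomorphic_on_imp_continuous_on continuous_on_subset)+
    define bad where "bad = (\<lambda>p :: (nat \<Rightarrow> complex) \<times> complex.
      \<forall>n. \<exists>j. \<phi> ((fst p)(0 := snd p)) (q j) < 1 / real (Suc n))"
    \<comment> \<open>A continuous function attains its minimum on the compact \<open>K\<close>. As
      \<open>q\<close> runs through a dense subset of \<open>K\<close>, this minimum is
      \<open>0\<close> exactly when the values along \<open>q\<close> fall below every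
      \<open>1 / (n + 1)\<close>.\<close>
    have bad_iff: "bad (y, c) \<longleftrightarrow> (\<exists>z\<in>K. \<phi> (y(0 := c)) z = 0)" if "good y" for y c
    proof -
      define a where "a = y(0 := c)"
      have a: "continuous_on K (\<phi> a)" unfolding a_def by (rule cont[OF good_radius[OF that]])
      show ?thesis
      proof
        assume b: "bad (y, c)"
        obtain w where w: "w \<in> K" "\<And>z. z \<in> K \<Longrightarrow> \<phi> a w \<le> \<phi> a z"
          using continuous_attains_inf[OF K(1,2) a] by metis
        have "\<phi> a w < 1 / real (Suc n)" for n
        proof -
          obtain j where "\<phi> a (q j) < 1 / real (Suc n)" using b by (auto simp: bad_def a_def)
          moreover have "q j \<in> K" using q T(2) by auto
          ultimately show ?thesis using w(2) by (meson le_less_trans)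
        qed
        moreover have "0 \<le> \<phi> a w" by (simp add: \<phi>_def)
        ultimately have "\<phi> a w = 0"
          by (metis less_eq_real_def less_asym nat_approx_posE)
        with w(1) show "\<exists>z\<in>K. \<phi> (y(0 := c)) z = 0" by (auto simp: a_def)
      next
        assume "\<exists>z\<in>K. \<phi> (y(0 := c)) z = 0"
        then obtain z where z: "z \<in> K" "\<phi> a z = 0" by (auto simp: a_def)
        have "\<exists>j. \<phi> a (q j) < \<epsilon>" if "0 < \<epsilon>" for \<epsilon>
        proof -
          obtain d where d: "0 < d" "\<And>x. x \<in> K \<Longrightarrow> dist x z < d \<Longrightarrow> dist (\<phi> a x) (\<phi> a z) < \<epsilon>"
            using a z(1) \<open>0 < \<epsilon>\<close> unfolding continuous_on_iff by metis
          obtain x where x: "x \<in> T" "dist x z < d"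
            using T(3) z(1) d(1) closure_approachable by (metis subsetD)
          then obtain j where "x = q j" using q by auto
          have "x \<in> K" using x(1) T(2) by auto
          then have "\<bar>\<phi> a x\<bar> < \<epsilon>" using d(2)[of x] x(2) z(2) by (simp add: dist_real_def)
          then have "\<phi> a (q j) < \<epsilon>" using \<open>x = q j\<close> by simp
          then show ?thesis by blast
        qed
        then show "bad (y, c)" by (auto simp: bad_def a_def)
      qed
    qed
    have bad_meas [measurable]: "Measurable.pred (N \<Otimes>\<^sub>M N0) (\<lambda>p. bad (fst p, snd p 0))"
      unfolding bad_def \<phi>_def power_series_def diffs_def fst_conv snd_conv by measurable
    \<comment> \<open>A bad \<open>c\<close> is minus the value of the series without constant term
      at a zero of its derivative in \<open>K\<close>. The derivative is nonzero at
      \<open>0\<close>, so it has finitely many zeros in the compact set \<open>K\<close>.\<close>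
    have fin: "finite {c. bad (y, c)}" if y: "good y" for y
    proof -
      note hol = holomorphic_power_series[OF good_radius[OF y]]
      have a1: "power_series (diffs y) 0 \<noteq> 0"
        using y by (simp add: power_series_def diffs_def good_def)
      have "finite {z \<in> K. power_series (diffs y) z = 0}"
      proof (cases "power_series (diffs y) constant_on ball 0 1")
        case True
        then have "power_series (diffs y) z = power_series (diffs y) 0" if "z \<in> K" for z
          using K(3) that unfolding constant_on_def by (metis centre_in_ball subsetD zero_less_one)
        with a1 have "{z \<in> K. power_series (diffs y) z = 0} = {}" by auto
        then show ?thesis by (simp only: finite.emptyI)
      next
        case False
        then show ?thesis
          using hol(2)[unfolded diffs_upd] K
          by (intro holomorphic_compact_finite_zeros[of _ "ball 0 1"]) auto
      qed
      moreover have "{c. bad (y, c)} \<subseteq>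
          (\<lambda>z. - power_series (y(0 := 0)) z) ` {z \<in> K. power_series (diffs y) z = 0}"
      proof
        fix c assume "c \<in> {c. bad (y, c)}"
        then obtain z where z: "z \<in> K" "\<phi> (y(0 := c)) z = 0" using bad_iff[OF y] by auto
        then have z0: "power_series (y(0 := c)) z = 0" "power_series (diffs y) z = 0"
          by (auto simp: \<phi>_def diffs_upd add_nonneg_eq_0_iff)
        have sm: "summable (\<lambda>n. (y(0 := c')) n * z ^ n)" for c'
        proof (rule summable_in_conv_radius)
          have "ereal (cmod z) < 1" using z(1) K(3) by auto
          then show "ereal (norm z) < conv_radius (y(0 := c'))"
            using good_radius[OF y] by (rule less_le_trans)
        qed
        have "power_series (y(0 := c')) z = c' + (\<Sum>n. y (Suc n) * z ^ Suc n)" for c'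
          unfolding power_series_def using suminf_split_head[OF sm[of c']] by simp
        then have "power_series (y(0 := c)) z = c + power_series (y(0 := 0)) z" by simp
        then have "c = - power_series (y(0 := 0)) z" using z0(1) by (simp add: eq_neg_iff_add_eq_0)
        then show "c \<in> (\<lambda>z. - power_series (y(0 := 0)) z) ` {z \<in> K. power_series (diffs y) z = 0}"
          using z z0 by blast
      qed
      ultimately show ?thesis by (rule finite_surj)
    qed
    interpret Y: prob_space "distr M N Y" by (rule prob_space_distr) measurable
    interpret X: prob_space "distr M N0 X" by (rule prob_space_distr) measurable
    interpret P: pair_sigma_finite "distr M N Y" "distr M N0 X" ..
    \<comment> \<open>Fubini for the product law: for almost every fixed \<open>y\<close>, the
      constant term avoids the finite set of bad values almost surely.\<close>
    have "AE p in distr M N Y \<Otimes>\<^sub>M distr M N0 X. \<not> bad (fst p, snd p 0)"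
    proof (rule P.AE_pair_measure)
      show "{p \<in> space (distr M N Y \<Otimes>\<^sub>M distr M N0 X). \<not> bad (fst p, snd p 0)}
          \<in> sets (distr M N Y \<Otimes>\<^sub>M distr M N0 X)"
        unfolding joint by measurable
      show "AE y in distr M N Y. AE x in distr M N0 X. \<not> bad (fst (y, x), snd (y, x) 0)"
        using AE_good
      proof eventually_elim
        case (elim y)
        have [measurable]: "{c. bad (y, c)} \<in> sets borel"
          using fin[OF elim] by (simp add: finite_imp_closed borel_closed)
        have "{x \<in> space N0. x 0 \<notin> {c. bad (y, c)}} \<in> sets N0" by measurable
        moreover have "AE \<omega> in M. f 0 \<omega> \<notin> {c. bad (y, c)}"
          using fin[OF elim] by (intro AE_std_complex_gaussian_notin[OF f] countable_finite)
        ultimately show ?case by (subst AE_distr_iff[OF X]) (simp_all add: X0)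
      qed
    qed
    then have "AE \<omega> in M. \<not> bad (Y \<omega>, f 0 \<omega>)"
      unfolding joint by (subst (asm) AE_distr_iff) (simp_all add: X0)
    moreover have "AE \<omega> in M. good (Y \<omega>)"
      using AE_good by (rule AE_distrD[OF Y])
    ultimately show ?thesis
    proof eventually_elim
      case (elim \<omega>)
      have "1 \<le> conv_radius (\<lambda>n. f n \<omega>)"
        using good_radius[OF elim(2), of "f 0 \<omega>"] by (simp only: Y_upd)
      then have "deriv (power_series (\<lambda>n. f n \<omega>)) z = power_series (diffs (\<lambda>n. f n \<omega>)) z" if "z \<in> K" for z
        using holomorphic_power_series(3) K(3) that by blast
      moreover have "\<phi> (\<lambda>n. f n \<omega>) z \<noteq> 0" if "z \<in> K" for z
        using elim that unfolding bad_iff[OF elim(2)] by (simp add: Y_upd)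
      then have "power_series (\<lambda>n. f n \<omega>) z \<noteq> 0 \<or> power_series (diffs (\<lambda>n. f n \<omega>)) z \<noteq> 0"
        if "z \<in> K" for z
        using that by (force simp: \<phi>_def)
      ultimately show ?case unfolding K_def[symmetric] by auto
    qed
  qed
  \<comment> \<open>Countably many compact discs of radius \<open>rad k\<close> exhaust the open
    disc, so the exceptional null sets can be united.\<close>
  then have "AE \<omega> in M. \<forall>k. \<forall>z\<in>cball 0 (rad k). power_series (\<lambda>n. f n \<omega>) z = 0 \<longrightarrow>
      deriv (power_series (\<lambda>n. f n \<omega>)) z \<noteq> 0"
    by (simp add: AE_all_countable)
  then show ?thesis
  proof eventually_elim
    case (elim \<omega>)
    have "\<exists>k. z \<in> cball 0 (rad k)" if "z \<in> ball 0 1" for z :: complex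
    proof -
      have "eventually (\<lambda>k. cmod z < rad k) sequentially"
        using rad_tendsto that by (intro order_tendstoD(1)) auto
      then show ?thesis by (auto dest!: eventually_happens intro: less_imp_le)
    qed
    with elim show ?case by blast
  qed
qed

end

section \<open>The upper bound for the radius of convergence and the conclusion\<close>

text \<open>With a larger radius the series would be continuous on the closed disc and thus itself
  an element of the Bergman space. It vanishes on its own zeros but not at the origin, where its
  value is \<open>a 0\<close>.\<close>

lemma conv_radius_le_1_of_uniqueness:
  assumes "bergman_uniqueness_set (disc_zeros (power_series a))" "a 0 \<noteq> 0"
  shows "conv_radius a \<le> 1"
proof (rule ccontr)
  assume "\<not> conv_radius a \<le> 1"
  then have R: "1 < conv_radius a" by simp
  have der: "(power_series a has_field_derivative power_series (diffs a) z) (at z)" if "z \<in> cball 0 1" for z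
  proof (rule power_series_has_field_derivative)
    have "ereal (cmod z) \<le> 1" using that by simp
    then show "ereal (cmod z) < conv_radius a" using R by (rule le_less_trans)
  qed
  have hol: "power_series a holomorphic_on cball 0 1"
    unfolding holomorphic_on_def field_differentiable_def
    using der has_field_derivative_at_within by blast
  have "set_integrable lborel (cball 0 1) (\<lambda>z. (cmod (power_series a z))\<^sup>2)"
    unfolding set_integrable_def
    by (intro borel_integrable_compact compact_cball continuous_intros holomorphic_on_imp_continuous_on hol)
  then have "set_integrable lborel (ball 0 1) (\<lambda>z. (cmod (power_series a z))\<^sup>2)"
    by (rule set_integrable_subset) auto
  moreover have "power_series a holomorphic_on ball 0 1"
    using hol by (rule holomorphic_on_subset) auto
  ultimately have "power_series a \<in> bergman_space" by (simp add: bergman_space_def)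
  then have "power_series a 0 = 0"
    using assms(1) by (auto simp: bergman_uniqueness_set_def disc_zeros_def)
  then show False using assms(2) by (simp add: power_series_def)
qed

theorem theorem1p1:
  fixes M :: "'a measure" and f :: "nat \<Rightarrow> 'a \<Rightarrow> complex"
  assumes "prob_space M"
    and "prob_space.indep_vars M (\<lambda>_. borel) f UNIV"
    and "\<And>n. std_complex_gaussian M (f n)"
  shows "AE \<omega> in M. conv_radius (\<lambda>n. f n \<omega>) = 1 \<and>
           bergman_uniqueness_set (disc_zeros (power_series (\<lambda>n. f n \<omega>)))"
proof -
  interpret prob_space M by fact
  \<comment> \<open>A nonzero constant term lets the uniqueness property itself bound the radius of
    convergence by \<open>1\<close>.\<close>
  have "AE \<omega> in M. f 0 \<omega> \<notin> {0}"
    by (rule AE_std_complex_gaussian_notin[OF assms(3)]) simp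
  with AE_conv_radius_ge_1[of M f, OF assms(3)] AE_power_series_simple_zeros[OF assms(2,3)]
    AE_frequently_annulus_defect_le[OF assms(2,3)]
  show ?thesis
  proof eventually_elim
    case (elim \<omega>)
    obtain C where C: "0 \<le> C" "\<exists>\<^sub>F k in sequentially.
        annulus_defect (rad k) (rad (Suc k)) (power_series (\<lambda>n. f n \<omega>))
          \<le> ennreal (C * measure lborel (annulus (rad k) (rad (Suc k))))"
      using elim(3) by blast
    have "bergman_uniqueness_set (disc_zeros (power_series (\<lambda>n. f n \<omega>)))"
      using elim(2) by (intro bergman_uniqueness_disc_zeros[OF holomorphic_power_series(1)[OF elim(1)] _ C]) auto
    moreover from this have "conv_radius (\<lambda>n. f n \<omega>) \<le> 1"
      using elim(4) by (intro conv_radius_le_1_of_uniqueness) auto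
    ultimately show ?case using elim(1) by (auto intro: antisym)
  qed
qed

end
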